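(* Let $\sigma>0$, let $\Omega=\{(\omega,c)\in\mathbb{R}^2:\ \omega>0,\ -2\sqrt{\omega}<c<2\sqrt{\omega}\}$, and for $(\omega,c)\in\Omega$ define on $\mathbb{R}$ $$\varphi_{\omega,c}(x)=\left\{\frac{(\sigma+1)(4\omega-c^2)}{2\sqrt{\omega}\,\cosh\!\big(\sigma\sqrt{4\omega-c^2}\,x\big)-c}\right\}^{\frac{1}{2\sigma}},$$ $$\phi_{\omega,c}(x)=\varphi_{\omega,c}(x)\exp\left\{\frac{c}{2}\,i x-\frac{i}{2\sigma+2}\int_{-\infty}^{x}\varphi_{\omega,c}^{2\sigma}(y)\,dy\right\}.$$ Then: (1) If $\sigma\in(0,2)$, then for every fixed $\omega>0$, $\|\phi_{\omega,c}\|_{H^1(\mathbb{R})}\to 0$ as $c\to-2\sqrt{\omega}$ (with $(\omega,c)\in\Omega$). (2) If $\sigma\ge 2$, then there exists a constant $c_0=c_0(\sigma)>0$ such that for every $(\omega,c)\in\Omega$, $$\|\phi_{\omega,c}\|_{\dot H^{s_c}(\mathbb{R})}\ge c_0,\qquad\text{where } s_c=\frac12-\frac{1}{2\sigma}.$$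
   Context: The functions $\phi_{\omega,c}$ are the profiles of the solitary wave solutions $u_{\omega,c}(t,x)=e^{i\omega t}\phi_{\omega,c}(x-ct)$ of the generalized derivative nonlinear Schrödinger equation $i\partial_t u+\partial_x^2u+i|u|^{2\sigma}\partial_xu=0$ on $\mathbb{R}\times\mathbb{R}$. Here $H^1(\mathbb{R})$ is the usual Sobolev space of complex-valued functions, and $\|f\|_{\dot H^{s}(\mathbb{R})}=\|D^{s}f\|_{L^2(\mathbb{R})}$ with $D^s=(-\partial_x^2)^{s/2}$ is the homogeneous Sobolev norm. *)

theory Defs
  imports "HOL-Analysis.Analysis"
begin

section \<open>Norms with values in the extended nonnegative reals\<close>

definition ennsqrt :: "ennreal \<Rightarrow> ennreal" where
  "ennsqrt x = (if x = \<infinity> then \<infinity> else ennreal (sqrt (enn2real x)))"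

definition L2_norm :: "(real \<Rightarrow> complex) \<Rightarrow> ennreal" where
  "L2_norm f = ennsqrt (\<integral>\<^sup>+ x. ennreal ((norm (f x))\<^sup>2) \<partial>lborel)"

definition L2_fun :: "(real \<Rightarrow> complex) set" where
  "L2_fun = {f. f \<in> borel_measurable lborel \<and> L2_norm f < \<infinity>}"

section \<open>The Sobolev space of order one\<close>

definition test_function :: "(real \<Rightarrow> real) \<Rightarrow> bool" where
  "test_function \<psi> \<longleftrightarrow>
     (\<forall>n. ((deriv ^^ n) \<psi>) differentiable_on UNIV) \<and> compact (closure {x. \<psi> x \<noteq> 0})"

definition weak_deriv :: "(real \<Rightarrow> complex) \<Rightarrow> (real \<Rightarrow> complex) \<Rightarrow> bool" where
  "weak_deriv f g \<longleftrightarrow>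
     (\<forall>\<psi>. test_function \<psi> \<longrightarrow>
        (LINT x|lborel. deriv \<psi> x *\<^sub>R f x) = - (LINT x|lborel. \<psi> x *\<^sub>R g x))"

text \<open>
  An \<open>L\<^sup>2\<close> weak derivative is unique almost everywhere, so the infimum is over at most one
  value; it is \<open>\<infinity>\<close> exactly when \<open>f\<close> is not in \<open>H\<^sup>1\<close>.
\<close>
definition H1_norm :: "(real \<Rightarrow> complex) \<Rightarrow> ennreal" where
  "H1_norm f =
     (INF g \<in> {g. f \<in> L2_fun \<and> g \<in> L2_fun \<and> weak_deriv f g}.
        ennsqrt ((L2_norm f)\<^sup>2 + (L2_norm g)\<^sup>2))"

section \<open>Fractional derivatives and homogeneous Sobolev norms\<close>

text \<open>
  The \<open>L\<^sup>2\<close> Fourier transform, in the unitary normalisation, as the \<open>L\<^sup>2\<close> limit of the transforms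
  of the truncations. It determines \<open>F\<close> up to null sets, hence it is a relation.
\<close>
definition truncated_fourier :: "(real \<Rightarrow> complex) \<Rightarrow> real \<Rightarrow> real \<Rightarrow> complex" where
  "truncated_fourier f R \<xi> =
     complex_of_real (1 / sqrt (2 * pi)) * (LINT x:{-R..R}|lborel. cis (- (x * \<xi>)) * f x)"

definition fourier_L2 :: "(real \<Rightarrow> complex) \<Rightarrow> (real \<Rightarrow> complex) \<Rightarrow> bool" where
  "fourier_L2 f F \<longleftrightarrow> f \<in> L2_fun \<and> F \<in> L2_fun \<and>
     ((\<lambda>R. L2_norm (\<lambda>\<xi>. truncated_fourier f R \<xi> - F \<xi>)) \<longlongrightarrow> 0) at_top"

text \<open>
  \<open>g\<close> is a representative of \<open>D\<^sup>s f\<close>: the operator \<open>-\<partial>\<^sub>x\<^sup>2\<close> has Fourier symbol \<open>\<xi>\<^sup>2\<close>, so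
  \<open>D\<^sup>s = (-\<partial>\<^sub>x\<^sup>2)\<^bsup>s/2\<^esup>\<close> has symbol \<open>\<bar>\<xi>\<bar>\<^sup>s\<close>. (For \<open>s = 0\<close> the value \<open>0 powr 0 = 0\<close> affects only
  the null set \<open>{0}\<close>.)
\<close>
definition frac_deriv :: "real \<Rightarrow> (real \<Rightarrow> complex) \<Rightarrow> (real \<Rightarrow> complex) \<Rightarrow> bool" where
  "frac_deriv s f g \<longleftrightarrow>
     (\<exists>F. fourier_L2 f F \<and> fourier_L2 g (\<lambda>\<xi>. complex_of_real (\<bar>\<xi>\<bar> powr s) * F \<xi>))"

text \<open>
  All representatives of \<open>D\<^sup>s f\<close> agree almost everywhere, so the infimum is over at most one value.
  For \<open>f\<close> in \<open>L\<^sup>2\<close> it is \<open>\<infinity>\<close> exactly when \<open>D\<^sup>s f\<close> is not in \<open>L\<^sup>2\<close>.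
\<close>
definition hom_sobolev_norm :: "real \<Rightarrow> (real \<Rightarrow> complex) \<Rightarrow> ennreal" where
  "hom_sobolev_norm s f = (INF g \<in> {g. frac_deriv s f g}. L2_norm g)"

section \<open>Solitary wave profiles\<close>

definition Omega :: "(real \<times> real) set" where
  "Omega = {(\<omega>, c). \<omega> > 0 \<and> - 2 * sqrt \<omega> < c \<and> c < 2 * sqrt \<omega>}"

definition varphi :: "real \<Rightarrow> real \<Rightarrow> real \<Rightarrow> real \<Rightarrow> real" where
  "varphi \<sigma> \<omega> c x =
     ((\<sigma> + 1) * (4 * \<omega> - c\<^sup>2) / (2 * sqrt \<omega> * cosh (\<sigma> * sqrt (4 * \<omega> - c\<^sup>2) * x) - c))
       powr (1 / (2 * \<sigma>))"

definition phi :: "real \<Rightarrow> real \<Rightarrow> real \<Rightarrow> real \<Rightarrow> complex" where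
  "phi \<sigma> \<omega> c x =
     complex_of_real (varphi \<sigma> \<omega> c x) *
     exp (complex_of_real (c / 2) * \<i> * complex_of_real x
          - \<i> / complex_of_real (2 * \<sigma> + 2)
            * complex_of_real (LINT y:{..x}|lborel. varphi \<sigma> \<omega> c y powr (2 * \<sigma>)))"

end

theory Submission
  imports Defs "HOL-Probability.Characteristic_Functions"
begin

text \<open>
  Everything rests on one pointwise identity. Put \<open>\<kappa> = sqrt (4 * \<omega> - c\<^sup>2)\<close> and
  \<open>q = varphi powr (2 * \<sigma>) / (\<sigma> + 1)\<close>. The logarithmic derivative \<open>h = \<phi>' / \<phi>\<close>
  of the profile is an explicit rational function of hyperbolic functions, and it satisfies
  \<open>\<bar>h\<bar> = sqrt \<omega>\<close> and \<open>h' = - \<i> * \<sigma> * q * h\<close> with \<open>0 < q \<le> 4 * sqrt \<omega>\<close>. Consequently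
  \<open>\<bar>\<phi>'\<bar> = sqrt \<omega> * \<bar>\<phi>\<bar>\<close> and \<open>\<bar>\<phi>''\<bar> \<le> (1 + 4 * \<sigma>) * \<omega> * \<bar>\<phi>\<bar>\<close> at every
  point: in the sense of \<open>L\<^sup>2\<close> the profile lives at frequencies of size \<open>sqrt \<omega>\<close>, uniformly in \<open>c\<close>.
  Both halves of the theorem thereby become statements about \<open>\<integral> \<bar>\<phi>\<bar>\<^sup>2\<close>.

  For \<open>\<sigma> < 2\<close> the square of the \<open>H\<^sup>1\<close> norm is \<open>(1 + \<omega>) * \<integral> \<bar>\<phi>\<bar>\<^sup>2\<close>. For \<open>c \<le> 0\<close> the bound
  \<open>varphi x \<le> C * \<kappa> powr (1 / \<sigma>) * exp (- \<kappa> * \<bar>x\<bar> / 2)\<close> makes this at most a constant times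
  \<open>\<kappa> powr (2 / \<sigma> - 1)\<close>, and \<open>\<kappa>\<close> tends to \<open>0\<close> as \<open>c\<close> tends to \<open>- 2 * sqrt \<omega>\<close>.

  For \<open>\<sigma> \<ge> 2\<close> let \<open>F\<close> be the Fourier transform of \<open>\<phi>\<close>. Plancherel's theorem for \<open>\<phi>'\<close> and \<open>\<phi>''\<close>
  turns the two pointwise facts into a lower bound for \<open>\<integral> \<xi>\<^sup>2 * \<bar>F\<bar>\<^sup>2\<close> and an upper bound for
  \<open>\<integral> \<xi>^4 * \<bar>F\<bar>\<^sup>2\<close>. Since \<open>\<xi>\<^sup>2\<close> is at most a multiple of \<open>\<bar>\<xi>\<bar> powr (2 * s)\<close> plus a small multiple of
  \<open>\<xi>^4\<close> (\<open>square_le_powr_plus_fourth\<close>), the fourth moment can be absorbed, and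
  \<open>\<omega> powr s * \<integral> \<bar>\<phi>\<bar>\<^sup>2\<close> is bounded by a multiple of the squared homogeneous norm of order \<open>s\<close>
  (\<open>hom_sobolev_norm_ge\<close>). Finally \<open>\<integral> \<bar>\<phi>\<bar>\<^sup>2\<close> is at least a constant times
  \<open>\<omega> powr (- s)\<close> for \<open>s = 1 / 2 - 1 / (2 * \<sigma>)\<close>: on the interval \<open>\<bar>x\<bar> \<le> 1 / (\<sigma> * \<kappa>)\<close> the profile
  is at least a constant times \<open>(\<kappa>\<^sup>2 / sqrt \<omega>) powr (1 / (2 * \<sigma>))\<close>, which contributes a multiple of
  \<open>\<kappa> powr (2 / \<sigma> - 1) * \<omega> powr (- 1 / (2 * \<sigma>))\<close>; the exponent of \<open>\<kappa>\<close> is nonpositive, and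
  \<open>\<kappa> \<le> 2 * sqrt \<omega>\<close>.

  Only two inequalities of Plancherel type are used, both obtained by Gaussian regularisation:
  \<open>plancherel_le\<close> for every integrable function, and \<open>plancherel_ge\<close> for integrable functions that are bounded
  and continuous.
\<close>

section \<open>The Fourier integral and Gaussian weights\<close>

text \<open>
  Without the unitary factor \<open>1 / sqrt (2 * pi)\<close>, so that duality has no constants; Plancherel's theorem then
  carries a factor \<open>2 * pi\<close>.
\<close>
definition fourier_integral :: "(real \<Rightarrow> complex) \<Rightarrow> real \<Rightarrow> complex" where
  "fourier_integral f \<xi> = (LINT x|lborel. cis (- (x * \<xi>)) * f x)"

lemma borel_measurable_cis [measurable]: "cis \<in> borel_measurable borel"
  by (intro borel_measurable_continuous_onI continuous_intros)

lemma borel_measurable_cnj [measurable]: "cnj \<in> borel_measurable borel"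
  by (intro borel_measurable_continuous_onI continuous_intros)

lemma borel_measurable_fourier_integral [measurable]:
  assumes [measurable]: "f \<in> borel_measurable lborel"
  shows "fourier_integral f \<in> borel_measurable borel"
proof -
  have "(\<lambda>\<xi>. LINT x|lborel. cis (- (x * \<xi>)) * f x) \<in> borel_measurable lborel"
    by measurable
  then show ?thesis
    by (simp add: fourier_integral_def [abs_def])
qed

lemma norm_fourier_integral_le: "norm (fourier_integral f \<xi>) \<le> (LINT x|lborel. norm (f x))"
  unfolding fourier_integral_def
  by (rule order.trans [OF integral_norm_bound]) (simp add: norm_mult)

lemma integrable_cis_mult:
  assumes "integrable lborel (f :: real \<Rightarrow> complex)"
  shows "integrable lborel (\<lambda>x. cis (a * x) * f x)"
  by (rule Bochner_Integration.integrable_bound [OF assms])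
     (use assms in \<open>auto simp: norm_mult\<close>)

text \<open>
  The basic duality of the Fourier integral, which is Fubini's theorem for
  \<open>w \<xi> * f x * cis (- (x * \<xi>))\<close>. It is the only exchange of integrals on the Fourier side.
\<close>
lemma multiplication_formula:
  assumes f: "integrable lborel f" and w: "integrable lborel w"
  shows "(LINT \<xi>|lborel. w \<xi> * fourier_integral f \<xi>) = (LINT x|lborel. f x * fourier_integral w x)"
proof -
  have [measurable]: "f \<in> borel_measurable borel" "w \<in> borel_measurable borel"
    using assms by auto
  have "integrable (lborel \<Otimes>\<^sub>M lborel) (\<lambda>(\<xi>, x). w \<xi> * f x * cis (- (x * \<xi>)))"
  proof (rule lborel_pair.Fubini_integrable)
    have "integrable lborel (\<lambda>\<xi>. norm (w \<xi>) * (LINT x|lborel. norm (f x)))"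
      using w by simp
    then show "integrable lborel
        (\<lambda>\<xi>. LINT x|lborel. norm (case (\<xi>, x) of (\<xi>, x) \<Rightarrow> w \<xi> * f x * cis (- (x * \<xi>))))"
      by (simp add: norm_mult)
    show "AE \<xi> in lborel. integrable lborel
        (\<lambda>x. case (\<xi>, x) of (\<xi>, x) \<Rightarrow> w \<xi> * f x * cis (- (x * \<xi>)))"
    proof (rule AE_I2)
      fix \<xi> :: real
      show "integrable lborel (\<lambda>x. case (\<xi>, x) of (\<xi>, x) \<Rightarrow> w \<xi> * f x * cis (- (x * \<xi>)))"
        using integrable_mult_right [OF integrable_cis_mult [OF f, of "-\<xi>"], of "w \<xi>"]
        by (simp add: mult_ac)
    qed
  qed measurable
  then have "(LINT x|lborel. LINT \<xi>|lborel. w \<xi> * f x * cis (- (x * \<xi>)))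
      = (LINT \<xi>|lborel. LINT x|lborel. w \<xi> * f x * cis (- (x * \<xi>)))"
    by (rule lborel_pair.Fubini_integral)
  then show ?thesis
    by (simp add: fourier_integral_def mult_ac flip: integral_mult_right_zero)
qed

text \<open>
  After rescaling this is the characteristic function of the standard normal distribution. The
  transform of the weight is written as a normal density because that is an approximate identity
  as \<open>\<epsilon>\<close> tends to \<open>0\<close>, while the weight itself tends to \<open>1\<close>.
\<close>
lemma fourier_integral_gaussian:
  assumes "\<epsilon> > 0"
  shows "fourier_integral (\<lambda>\<xi>. complex_of_real (exp (- (\<epsilon> * \<xi>)\<^sup>2 / 2))) u
      = complex_of_real (2 * pi * normal_density 0 \<epsilon> u)"
proof -
  have "complex_of_real (exp (- (u / \<epsilon>)\<^sup>2 / 2)) = char std_normal_distribution (- (u / \<epsilon>))"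
    by (simp add: char_std_normal_distribution)
  also have "\<dots> = (LINT x|lborel. std_normal_density x *\<^sub>R cis (- (u / \<epsilon>) * x))"
    unfolding char_def by (subst integral_density) (auto simp: cis_conv_exp)
  also have "\<dots> = \<epsilon> *\<^sub>R (LINT \<xi>|lborel. std_normal_density (\<epsilon> * \<xi>) *\<^sub>R cis (- (u / \<epsilon>) * (\<epsilon> * \<xi>)))"
    using assms by (subst lborel_integral_real_affine [where c = \<epsilon> and t = 0]) auto
  also have "\<dots> = \<epsilon> *\<^sub>R (LINT \<xi>|lborel. complex_of_real (1 / sqrt (2 * pi)) *
      (cis (- (\<xi> * u)) * complex_of_real (exp (- (\<epsilon> * \<xi>)\<^sup>2 / 2))))"
    using assms by (simp add: std_normal_density_def scaleR_conv_of_real mult_ac)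
  also have "\<dots> = complex_of_real (\<epsilon> / sqrt (2 * pi)) *
      fourier_integral (\<lambda>\<xi>. complex_of_real (exp (- (\<epsilon> * \<xi>)\<^sup>2 / 2))) u"
    by (simp add: fourier_integral_def scaleR_conv_of_real)
  finally have "fourier_integral (\<lambda>\<xi>. complex_of_real (exp (- (\<epsilon> * \<xi>)\<^sup>2 / 2))) u
      = complex_of_real (sqrt (2 * pi) / \<epsilon> * exp (- (u / \<epsilon>)\<^sup>2 / 2))"
    using assms by (simp add: field_simps)
  also have "sqrt (2 * pi) / \<epsilon> * exp (- (u / \<epsilon>)\<^sup>2 / 2) = 2 * pi * normal_density 0 \<epsilon> u"
  proof -
    have "sqrt (2 * pi * \<epsilon>\<^sup>2) = sqrt (2 * pi) * \<epsilon>"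
      using assms by (simp add: real_sqrt_mult)
    moreover have "sqrt (2 * pi) * sqrt (2 * pi) = 2 * pi"
      by simp
    ultimately show ?thesis
      using assms by (simp add: normal_density_def field_simps power_divide)
  qed
  finally show ?thesis .
qed

lemma integrable_gaussian:
  assumes "\<epsilon> > 0"
  shows "integrable lborel (\<lambda>\<xi>::real. exp (- (\<epsilon> * \<xi>)\<^sup>2 / 2))"
proof -
  have "integrable lborel (\<lambda>\<xi>. sqrt (2 * pi) * std_normal_density (0 + \<epsilon> * \<xi>))"
    using assms by (intro integrable_mult_right lborel_integrable_real_affine) auto
  then show ?thesis
    by (simp add: std_normal_density_def)
qed

text \<open>
  The square of the \<open>L\<^sup>2\<close> norm of the transform need not be finite a priori. The Gaussian weight makes the
  integral converge and permits the multiplication formula to be used twice, once for each factor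
  of \<open>\<bar>fourier_integral f\<bar>\<^sup>2\<close>; what remains is the quadratic form of a Gaussian convolution.
\<close>
lemma gaussian_weighted_norm_square:
  fixes f :: "real \<Rightarrow> complex"
  assumes f: "integrable lborel f" and "\<epsilon> > 0"
  shows "complex_of_real
        (LINT \<xi>|lborel. exp (- (\<epsilon> * \<xi>)\<^sup>2 / 2) * (norm (fourier_integral f \<xi>))\<^sup>2)
      = 2 * pi * (LINT x|lborel. f x * cnj (LINT y|lborel. f y * normal_density 0 \<epsilon> (y - x)))"
proof -
  have [measurable]: "f \<in> borel_measurable borel"
    using f by auto
  define w where "w \<xi> = complex_of_real (exp (- (\<epsilon> * \<xi>)\<^sup>2 / 2))" for \<xi>
  have w: "integrable lborel w"
    unfolding w_def using integrable_gaussian [OF \<open>\<epsilon> > 0\<close>] by (rule integrable_of_real)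
  then have [measurable]: "w \<in> borel_measurable borel"
    by auto
  have cw: "cnj (w \<xi>) = w \<xi>" for \<xi>
    by (simp add: w_def)
  have wf: "integrable lborel (\<lambda>\<xi>. w \<xi> * cnj (fourier_integral f \<xi>))"
  proof (rule Bochner_Integration.integrable_bound)
    show "integrable lborel (\<lambda>\<xi>. w \<xi> * (LINT x|lborel. norm (f x)))"
      using w by simp
    have "0 \<le> (LINT x|lborel. norm (f x))" by simp
    then show "AE \<xi> in lborel. norm (w \<xi> * cnj (fourier_integral f \<xi>))
        \<le> norm (w \<xi> * complex_of_real (LINT x|lborel. norm (f x)))"
      by (intro AE_I2) (simp add: norm_mult mult_left_mono norm_fourier_integral_le)
  qed measurable
  have modulated: "fourier_integral (\<lambda>\<xi>. cis (x * \<xi>) * w \<xi>) y = 2 * pi * normal_density 0 \<epsilon> (y - x)"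
    for x y
  proof -
    have "fourier_integral (\<lambda>\<xi>. cis (x * \<xi>) * w \<xi>) y = fourier_integral w (y - x)"
      unfolding fourier_integral_def
      by (rule Bochner_Integration.integral_cong [OF refl])
         (simp add: cis_mult algebra_simps flip: mult.assoc)
    then show ?thesis
      unfolding w_def [abs_def] using fourier_integral_gaussian [OF \<open>\<epsilon> > 0\<close>] by simp
  qed
  have inner: "fourier_integral (\<lambda>\<xi>. w \<xi> * cnj (fourier_integral f \<xi>)) x
      = 2 * pi * cnj (LINT y|lborel. f y * normal_density 0 \<epsilon> (y - x))" for x
  proof -
    have "fourier_integral (\<lambda>\<xi>. w \<xi> * cnj (fourier_integral f \<xi>)) x
        = (LINT \<xi>|lborel. cnj ((cis (x * \<xi>) * w \<xi>) * fourier_integral f \<xi>))"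
      unfolding fourier_integral_def [of "\<lambda>\<xi>. w \<xi> * cnj (fourier_integral f \<xi>)"]
      by (rule Bochner_Integration.integral_cong [OF refl]) (simp add: cis_cnj cw mult_ac)
    also have "\<dots> = cnj (LINT \<xi>|lborel. (cis (x * \<xi>) * w \<xi>) * fourier_integral f \<xi>)"
      by (rule Bochner_Integration.integral_cnj)
    also have "(LINT \<xi>|lborel. (cis (x * \<xi>) * w \<xi>) * fourier_integral f \<xi>)
        = (LINT y|lborel. f y * fourier_integral (\<lambda>\<xi>. cis (x * \<xi>) * w \<xi>) y)"
      by (rule multiplication_formula [OF f integrable_cis_mult [OF w]])
    also have "\<dots> = (LINT y|lborel. 2 * pi * (f y * normal_density 0 \<epsilon> (y - x)))"
      unfolding modulated by (rule Bochner_Integration.integral_cong [OF refl]) simp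
    finally show ?thesis
      by simp
  qed
  have "complex_of_real (LINT \<xi>|lborel. exp (- (\<epsilon> * \<xi>)\<^sup>2 / 2) * (norm (fourier_integral f \<xi>))\<^sup>2)
      = (LINT \<xi>|lborel. (w \<xi> * cnj (fourier_integral f \<xi>)) * fourier_integral f \<xi>)"
    unfolding integral_complex_of_real [symmetric]
    by (rule Bochner_Integration.integral_cong [OF refl])
       (simp add: w_def complex_norm_square mult_ac del: of_real_power)
  also have "\<dots> = (LINT x|lborel. f x * fourier_integral (\<lambda>\<xi>. w \<xi> * cnj (fourier_integral f \<xi>)) x)"
    by (rule multiplication_formula [OF f wf])
  also have "\<dots> = (LINT x|lborel. 2 * pi *
      (f x * cnj (LINT y|lborel. f y * normal_density 0 \<epsilon> (y - x))))"
    unfolding inner by (simp add: mult_ac)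
  finally show ?thesis
    by simp
qed

lemma integrable_gaussian_fourier:
  assumes f: "integrable lborel f" and "\<epsilon> > 0"
  shows "integrable lborel (\<lambda>\<xi>. exp (- (\<epsilon> * \<xi>)\<^sup>2 / 2) * (norm (fourier_integral f \<xi>))\<^sup>2)"
proof (rule Bochner_Integration.integrable_bound)
  have [measurable]: "f \<in> borel_measurable borel"
    using f by auto
  show "integrable lborel (\<lambda>\<xi>. exp (- (\<epsilon> * \<xi>)\<^sup>2 / 2) * (LINT x|lborel. norm (f x))\<^sup>2)"
    using integrable_gaussian [OF \<open>\<epsilon> > 0\<close>] by simp
  show "AE \<xi> in lborel. norm (exp (- (\<epsilon> * \<xi>)\<^sup>2 / 2) * (norm (fourier_integral f \<xi>))\<^sup>2)
      \<le> norm (exp (- (\<epsilon> * \<xi>)\<^sup>2 / 2) * (LINT x|lborel. norm (f x))\<^sup>2)"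
    by (intro AE_I2) (simp add: power_mono norm_fourier_integral_le)
  show "(\<lambda>\<xi>. exp (- (\<epsilon> * \<xi>)\<^sup>2 / 2) * (norm (fourier_integral f \<xi>))\<^sup>2) \<in> borel_measurable lborel"
    by measurable
qed

lemma nn_integral_normal_density:
  assumes "\<epsilon> > 0"
  shows "(\<integral>\<^sup>+y. ennreal (normal_density 0 \<epsilon> (y - x)) \<partial>lborel) = 1"
    and "(\<integral>\<^sup>+x. ennreal (normal_density 0 \<epsilon> (y - x)) \<partial>lborel) = 1"
proof -
  have 1: "(\<integral>\<^sup>+y. ennreal (normal_density 0 \<epsilon> y) \<partial>lborel) = 1"
    using assms by (subst nn_integral_eq_integral) auto
  show "(\<integral>\<^sup>+y. ennreal (normal_density 0 \<epsilon> (y - x)) \<partial>lborel) = 1"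
    using 1 nn_integral_real_affine [of "\<lambda>y. ennreal (normal_density 0 \<epsilon> y)" 1 "-x"] by simp
  show "(\<integral>\<^sup>+x. ennreal (normal_density 0 \<epsilon> (y - x)) \<partial>lborel) = 1"
    using 1 nn_integral_real_affine [of "\<lambda>y. ennreal (normal_density 0 \<epsilon> y)" "-1" "y"] by simp
qed

section \<open>Inequalities of Plancherel type\<close>

lemma norm_integral_le_nn_integral:
  fixes f :: "'a \<Rightarrow> 'b::{banach, second_countable_topology}"
  shows "ennreal (norm (integral\<^sup>L M f)) \<le> (\<integral>\<^sup>+x. ennreal (norm (f x)) \<partial>M)"
  by (cases "integrable M f") (simp_all add: integral_norm_bound_ennreal not_integrable_integral_eq)

text \<open>
  Convolution with a probability density contracts \<open>L\<^sup>2\<close>. The inequality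
  \<open>\<bar>f x\<bar> * \<bar>f y\<bar> \<le> \<bar>f x\<bar>\<^sup>2 / 2 + \<bar>f y\<bar>\<^sup>2 / 2\<close> under the double integral is enough, as the kernel
  has integral one in each variable.
\<close>
lemma gaussian_form_le:
  fixes f :: "real \<Rightarrow> complex"
  assumes f [measurable]: "f \<in> borel_measurable borel" and "\<epsilon> > 0"
  shows "ennreal (norm (LINT x|lborel. f x * cnj (LINT y|lborel. f y * normal_density 0 \<epsilon> (y - x))))
      \<le> (\<integral>\<^sup>+x. ennreal ((norm (f x))\<^sup>2) \<partial>lborel)" (is "_ \<le> ?A")
proof -
  let ?N = "\<lambda>x y. normal_density 0 \<epsilon> (y - x)"
  have "ennreal (norm (LINT x|lborel. f x * cnj (LINT y|lborel. f y * ?N x y)))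
      \<le> (\<integral>\<^sup>+x. ennreal (norm (f x)) * ennreal (norm (LINT y|lborel. f y * ?N x y)) \<partial>lborel)"
    by (rule order.trans [OF norm_integral_le_nn_integral]) (simp add: norm_mult ennreal_mult)
  also have "\<dots> \<le> (\<integral>\<^sup>+x. ennreal (norm (f x)) * (\<integral>\<^sup>+y. ennreal (norm (f y * ?N x y)) \<partial>lborel) \<partial>lborel)"
    by (intro nn_integral_mono mult_left_mono norm_integral_le_nn_integral) auto
  also have "\<dots> = (\<integral>\<^sup>+x. \<integral>\<^sup>+y. ennreal (norm (f x)) * ennreal (norm (f y * ?N x y)) \<partial>lborel \<partial>lborel)"
    by (subst nn_integral_cmult) auto
  also have "\<dots> \<le> (\<integral>\<^sup>+x. \<integral>\<^sup>+y. ennreal ((norm (f x))\<^sup>2 / 2) * ennreal (?N x y)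
      + ennreal ((norm (f y))\<^sup>2 / 2) * ennreal (?N x y) \<partial>lborel \<partial>lborel)"
  proof (intro nn_integral_mono)
    fix x y :: real
    have "norm (f x) * norm (f y) \<le> (norm (f x))\<^sup>2 / 2 + (norm (f y))\<^sup>2 / 2"
      using sum_squares_bound [of "norm (f x)" "norm (f y)"] by simp
    then have "norm (f x) * norm (f y) * ?N x y \<le> ((norm (f x))\<^sup>2 / 2 + (norm (f y))\<^sup>2 / 2) * ?N x y"
      by (rule mult_right_mono) simp
    then have "norm (f x) * norm (f y * ?N x y)
        \<le> (norm (f x))\<^sup>2 / 2 * ?N x y + (norm (f y))\<^sup>2 / 2 * ?N x y"
      by (simp add: norm_mult algebra_simps)
    then show "ennreal (norm (f x)) * ennreal (norm (f y * ?N x y))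
        \<le> ennreal ((norm (f x))\<^sup>2 / 2) * ennreal (?N x y)
          + ennreal ((norm (f y))\<^sup>2 / 2) * ennreal (?N x y)"
      by (simp flip: ennreal_mult ennreal_plus add: ennreal_leI)
  qed
  also have "\<dots> = (\<integral>\<^sup>+x. \<integral>\<^sup>+y. ennreal ((norm (f x))\<^sup>2 / 2) * ennreal (?N x y) \<partial>lborel \<partial>lborel)
      + (\<integral>\<^sup>+x. \<integral>\<^sup>+y. ennreal ((norm (f y))\<^sup>2 / 2) * ennreal (?N x y) \<partial>lborel \<partial>lborel)"
    by (subst nn_integral_add [symmetric]) (auto intro!: nn_integral_cong nn_integral_add)
  also have "(\<integral>\<^sup>+x. \<integral>\<^sup>+y. ennreal ((norm (f y))\<^sup>2 / 2) * ennreal (?N x y) \<partial>lborel \<partial>lborel)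
      = (\<integral>\<^sup>+y. \<integral>\<^sup>+x. ennreal ((norm (f y))\<^sup>2 / 2) * ennreal (?N x y) \<partial>lborel \<partial>lborel)"
    by (rule lborel_pair.Fubini') measurable
  also have "\<dots> = (\<integral>\<^sup>+y. ennreal ((norm (f y))\<^sup>2 / 2) \<partial>lborel)"
    using nn_integral_normal_density [OF \<open>\<epsilon> > 0\<close>] by (simp add: nn_integral_cmult)
  also have "(\<integral>\<^sup>+x. \<integral>\<^sup>+y. ennreal ((norm (f x))\<^sup>2 / 2) * ennreal (?N x y) \<partial>lborel \<partial>lborel)
      = (\<integral>\<^sup>+y. ennreal ((norm (f y))\<^sup>2 / 2) \<partial>lborel)"
    using nn_integral_normal_density [OF \<open>\<epsilon> > 0\<close>] by (simp add: nn_integral_cmult)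
  also have "(\<integral>\<^sup>+y. ennreal ((norm (f y))\<^sup>2 / 2) \<partial>lborel)
      + (\<integral>\<^sup>+y. ennreal ((norm (f y))\<^sup>2 / 2) \<partial>lborel) = ?A"
    by (subst nn_integral_add [symmetric]) (auto simp flip: ennreal_plus)
  finally show ?thesis .
qed

text \<open>
  The weighted integrals are uniformly bounded by \<open>gaussian_form_le\<close>, and Fatou's lemma removes the
  weight. Both sides are allowed to be infinite.
\<close>
lemma plancherel_le:
  assumes f: "integrable lborel f"
  shows "(\<integral>\<^sup>+\<xi>. ennreal ((norm (fourier_integral f \<xi>))\<^sup>2) \<partial>lborel)
      \<le> ennreal (2 * pi) * (\<integral>\<^sup>+x. ennreal ((norm (f x))\<^sup>2) \<partial>lborel)"
proof -
  have [measurable]: "f \<in> borel_measurable borel"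
    using f by auto
  define w where "w n \<xi> = exp (- (1 / Suc n * \<xi>)\<^sup>2 / 2)" for n :: nat and \<xi> :: real
  have [measurable]: "w n \<in> borel_measurable borel" for n
    unfolding w_def by measurable
  let ?g = "\<lambda>\<xi>. (norm (fourier_integral f \<xi>))\<^sup>2"
  have "(\<lambda>n. w n \<xi>) \<longlonglongrightarrow> exp (- (0 * \<xi>)\<^sup>2 / 2)" for \<xi>
    unfolding w_def by (intro tendsto_intros lim_1_over_n [THEN LIMSEQ_Suc]) auto
  then have "(\<lambda>n. ennreal (w n \<xi> * ?g \<xi>)) \<longlonglongrightarrow> ennreal (1 * ?g \<xi>)" for \<xi>
    by (intro tendsto_ennrealI tendsto_mult tendsto_const) simp
  then have "liminf (\<lambda>n. ennreal (w n \<xi> * ?g \<xi>)) = ennreal (?g \<xi>)" for \<xi>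
    by (intro lim_imp_Liminf) auto
  then have "(\<integral>\<^sup>+\<xi>. ennreal (?g \<xi>) \<partial>lborel)
      = (\<integral>\<^sup>+\<xi>. liminf (\<lambda>n. ennreal (w n \<xi> * ?g \<xi>)) \<partial>lborel)"
    by simp
  also have "\<dots> \<le> liminf (\<lambda>n. \<integral>\<^sup>+\<xi>. ennreal (w n \<xi> * ?g \<xi>) \<partial>lborel)"
    by (rule nn_integral_liminf) measurable
  also have "\<dots> \<le> limsup (\<lambda>n. \<integral>\<^sup>+\<xi>. ennreal (w n \<xi> * ?g \<xi>) \<partial>lborel)"
    by (rule Liminf_le_Limsup) simp
  also have "\<dots> \<le> ennreal (2 * pi) * (\<integral>\<^sup>+x. ennreal ((norm (f x))\<^sup>2) \<partial>lborel)"
  proof (rule Limsup_bounded, rule always_eventually, rule allI)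
    fix n
    let ?I = "LINT x|lborel. f x * cnj (LINT y|lborel. f y * normal_density 0 (1 / Suc n) (y - x))"
    have eps: "1 / real (Suc n) > 0" by simp
    have "(\<integral>\<^sup>+\<xi>. ennreal (w n \<xi> * ?g \<xi>) \<partial>lborel) = ennreal (LINT \<xi>|lborel. w n \<xi> * ?g \<xi>)"
      unfolding w_def
      by (rule nn_integral_eq_integral [OF integrable_gaussian_fourier [OF f eps]]) simp
    also have "(LINT \<xi>|lborel. w n \<xi> * ?g \<xi>) = norm (complex_of_real (LINT \<xi>|lborel. w n \<xi> * ?g \<xi>))"
      by (simp add: w_def integral_nonneg_AE)
    also have "\<dots> = 2 * pi * norm ?I"
      unfolding w_def gaussian_weighted_norm_square [OF f eps] by (simp add: norm_mult)
    also have "ennreal (2 * pi * norm ?I) = ennreal (2 * pi) * ennreal (norm ?I)"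
      by (simp add: ennreal_mult)
    also have "\<dots> \<le> ennreal (2 * pi) * (\<integral>\<^sup>+x. ennreal ((norm (f x))\<^sup>2) \<partial>lborel)"
      by (intro mult_left_mono gaussian_form_le eps) auto
    finally show "(\<integral>\<^sup>+\<xi>. ennreal (w n \<xi> * ?g \<xi>) \<partial>lborel)
        \<le> ennreal (2 * pi) * (\<integral>\<^sup>+x. ennreal ((norm (f x))\<^sup>2) \<partial>lborel)" .
  qed
  finally show ?thesis .
qed

text \<open>
  Rescaling the convolution variable moves \<open>\<epsilon>\<close> from the kernel into the argument of \<open>f\<close>, where
  continuity of \<open>f\<close> can act.
\<close>
lemma integral_normal_density_shift:
  fixes f :: "real \<Rightarrow> complex"
  assumes "\<epsilon> > 0"
  shows "(LINT y|lborel. f y * normal_density 0 \<epsilon> (y - x))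
      = (LINT z|lborel. f (x + \<epsilon> * z) * std_normal_density z)"
proof -
  have "sqrt (2 * pi * \<epsilon>\<^sup>2) = sqrt (2 * pi) * \<epsilon>"
    using assms by (simp add: real_sqrt_mult)
  then have "\<epsilon> * normal_density 0 \<epsilon> (\<epsilon> * z) = std_normal_density z" for z
    using assms by (simp add: normal_density_def power_mult_distrib)
  then have *: "complex_of_real \<epsilon> * complex_of_real (normal_density 0 \<epsilon> (\<epsilon> * z))
      = complex_of_real (std_normal_density z)" for z
    by (metis of_real_mult)
  have "(LINT y|lborel. f y * normal_density 0 \<epsilon> (y - x))
      = (LINT z|lborel. complex_of_real \<epsilon> * (f (x + \<epsilon> * z) * normal_density 0 \<epsilon> (\<epsilon> * z)))"
    using assms
    by (subst lborel_integral_real_affine [where c = \<epsilon> and t = x])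
       (auto simp: scaleR_conv_of_real)
  also have "\<dots> = (LINT z|lborel. f (x + \<epsilon> * z) * std_normal_density z)"
    by (simp add: mult.left_commute [of "complex_of_real \<epsilon>"] *)
  finally show ?thesis .
qed

text \<open>
  For a bounded continuous function the Gaussian convolutions \<open>g n\<close> converge pointwise to \<open>f\<close> and stay below
  the bound of \<open>f\<close>, so the regularised form converges to \<open>\<integral> \<bar>f\<bar>\<^sup>2\<close> by dominated convergence; the weight
  is at most one, so each regularised form is below the right-hand side.
\<close>
lemma plancherel_ge:
  assumes f: "integrable lborel f" and cont: "continuous_on UNIV f"
    and bound: "\<And>x. norm (f x) \<le> B"
  shows "ennreal (2 * pi) * (\<integral>\<^sup>+x. ennreal ((norm (f x))\<^sup>2) \<partial>lborel)
      \<le> (\<integral>\<^sup>+\<xi>. ennreal ((norm (fourier_integral f \<xi>))\<^sup>2) \<partial>lborel)" (is "_ \<le> ?R")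
proof -
  have [measurable]: "f \<in> borel_measurable borel"
    using f by auto
  have "B \<ge> 0"
    using bound [of 0] norm_ge_zero order.trans by blast
  define \<epsilon> where "\<epsilon> n = 1 / real (Suc n)" for n
  have eps: "\<epsilon> n > 0" for n by (simp add: \<epsilon>_def)
  have eps_lim: "\<epsilon> \<longlonglongrightarrow> 0"
    unfolding \<epsilon>_def using lim_1_over_n [THEN LIMSEQ_Suc] by simp
  define g where "g n x = (LINT z|lborel. f (x + \<epsilon> n * z) * std_normal_density z)" for n x
  have g_meas [measurable]: "g n \<in> borel_measurable borel" for n
  proof -
    have "(\<lambda>x. LINT z|lborel. f (x + \<epsilon> n * z) * std_normal_density z) \<in> borel_measurable lborel"
      by measurable
    then show ?thesis by (simp add: g_def [abs_def])
  qed
  have g_lim: "(\<lambda>n. g n x) \<longlonglongrightarrow> f x" for x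
  proof -
    have "(\<lambda>n. g n x) \<longlonglongrightarrow> (LINT z|lborel. f x * std_normal_density z)"
      unfolding g_def
    proof (rule integral_dominated_convergence)
      show "integrable lborel (\<lambda>z. B * std_normal_density z)" by simp
      show "AE z in lborel. (\<lambda>n. f (x + \<epsilon> n * z) * std_normal_density z)
          \<longlonglongrightarrow> f x * std_normal_density z"
      proof (rule AE_I2)
        fix z
        have "(\<lambda>n. x + \<epsilon> n * z) \<longlonglongrightarrow> x + 0 * z"
          by (intro tendsto_intros eps_lim)
        then have "(\<lambda>n. f (x + \<epsilon> n * z)) \<longlonglongrightarrow> f x"
          using cont by (intro continuous_on_tendsto_compose [OF cont]) auto
        then show "(\<lambda>n. f (x + \<epsilon> n * z) * std_normal_density z) \<longlonglongrightarrow> f x * std_normal_density z"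
          by (intro tendsto_intros)
      qed
      show "AE z in lborel. norm (f (x + \<epsilon> n * z) * std_normal_density z)
          \<le> B * std_normal_density z" for n
        by (intro AE_I2) (auto simp: norm_mult bound intro!: mult_right_mono)
    qed measurable
    also have "(LINT z|lborel. f x * complex_of_real (std_normal_density z)) = f x"
      by simp
    finally show ?thesis .
  qed
  have g_le: "norm (g n x) \<le> B" for n x
  proof -
    have "ennreal (norm (g n x)) \<le> (\<integral>\<^sup>+z. ennreal (norm (f (x + \<epsilon> n * z) * std_normal_density z)) \<partial>lborel)"
      unfolding g_def by (rule norm_integral_le_nn_integral)
    also have "\<dots> \<le> (\<integral>\<^sup>+z. ennreal (B * std_normal_density z) \<partial>lborel)"
      by (intro nn_integral_mono ennreal_leI) (auto simp: norm_mult bound intro!: mult_right_mono)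
    also have "\<dots> = ennreal B"
      using \<open>B \<ge> 0\<close> by (subst nn_integral_eq_integral) auto
    finally show ?thesis
      using \<open>B \<ge> 0\<close> by simp
  qed
  have "(\<lambda>n. LINT x|lborel. f x * cnj (g n x)) \<longlonglongrightarrow> (LINT x|lborel. f x * cnj (f x))"
  proof (rule integral_dominated_convergence)
    show "integrable lborel (\<lambda>x. norm (f x) * B)"
      using f by simp
    show "AE x in lborel. (\<lambda>n. f x * cnj (g n x)) \<longlonglongrightarrow> f x * cnj (f x)"
      by (intro AE_I2 tendsto_intros g_lim)
    show "AE x in lborel. norm (f x * cnj (g n x)) \<le> norm (f x) * B" for n
      by (intro AE_I2) (simp add: norm_mult g_le mult_left_mono)
  qed measurable
  also have "(LINT x|lborel. f x * cnj (f x)) = complex_of_real (LINT x|lborel. (norm (f x))\<^sup>2)"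
    by (simp add: complex_norm_square del: of_real_power flip: integral_complex_of_real)
  finally have lim: "(\<lambda>n. 2 * pi * Re (LINT x|lborel. f x * cnj (g n x)))
      \<longlonglongrightarrow> 2 * pi * (LINT x|lborel. (norm (f x))\<^sup>2)"
    by (intro tendsto_intros) (auto dest: tendsto_Re)
  have "ennreal (2 * pi * Re (LINT x|lborel. f x * cnj (g n x))) \<le> ?R" for n
  proof -
    have "complex_of_real
          (LINT \<xi>|lborel. exp (- (\<epsilon> n * \<xi>)\<^sup>2 / 2) * (norm (fourier_integral f \<xi>))\<^sup>2)
        = 2 * pi * (LINT x|lborel. f x * cnj (g n x))"
      unfolding gaussian_weighted_norm_square [OF f eps] integral_normal_density_shift [OF eps] g_def ..
    from arg_cong [OF this, of Re]
    have "2 * pi * Re (LINT x|lborel. f x * cnj (g n x))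
        = (LINT \<xi>|lborel. exp (- (\<epsilon> n * \<xi>)\<^sup>2 / 2) * (norm (fourier_integral f \<xi>))\<^sup>2)"
      by simp
    also have "ennreal \<dots> = (\<integral>\<^sup>+\<xi>. ennreal (exp (- (\<epsilon> n * \<xi>)\<^sup>2 / 2) * (norm (fourier_integral f \<xi>))\<^sup>2) \<partial>lborel)"
      by (rule nn_integral_eq_integral [OF integrable_gaussian_fourier [OF f eps], symmetric]) simp
    also have "\<dots> \<le> ?R"
      by (intro nn_integral_mono ennreal_leI mult_left_le_one_le) auto
    finally show ?thesis .
  qed
  then have "ennreal (2 * pi * (LINT x|lborel. (norm (f x))\<^sup>2)) \<le> ?R"
    by (intro tendsto_upperbound [OF tendsto_ennrealI [OF lim]] always_eventually) auto
  moreover have "integrable lborel (\<lambda>x. (norm (f x))\<^sup>2)"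
  proof (rule Bochner_Integration.integrable_bound)
    show "integrable lborel (\<lambda>x. B * norm (f x))"
      using f by simp
    show "AE x in lborel. norm ((norm (f x))\<^sup>2) \<le> norm (B * norm (f x))"
      using \<open>B \<ge> 0\<close> by (intro AE_I2) (auto simp: power2_eq_square bound intro!: mult_right_mono)
  qed measurable
  then have "(\<integral>\<^sup>+x. ennreal ((norm (f x))\<^sup>2) \<partial>lborel) = ennreal (LINT x|lborel. (norm (f x))\<^sup>2)"
    by (intro nn_integral_eq_integral) auto
  ultimately show ?thesis
    by (simp add: ennreal_mult)
qed

section \<open>Derivatives\<close>

lemma integral_derivative_eq_0:
  fixes f :: "real \<Rightarrow> complex"
  assumes "\<And>x. (F has_vector_derivative f x) (at x)" "continuous_on UNIV f" "integrable lborel f"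
    and "(F \<longlongrightarrow> 0) at_top" "(F \<longlongrightarrow> 0) at_bot"
  shows "(LINT x|lborel. f x) = 0"
proof -
  have "(LBINT x=-\<infinity>..\<infinity>. f x) = 0 - 0"
  proof (rule interval_integral_FTC_integrable)
    show "((F \<circ> real_of_ereal) \<longlongrightarrow> 0) (at_right (- \<infinity>))"
      using assms(5) by (simp add: ereal_tendsto_simps)
    show "((F \<circ> real_of_ereal) \<longlongrightarrow> 0) (at_left \<infinity>)"
      using assms(4) by (simp add: ereal_tendsto_simps)
    show "isCont f x" for x
      using assms(2) by (simp add: continuous_on_eq_continuous_at)
    show "set_integrable lborel (einterval (-\<infinity>) \<infinity>) f"
      using assms(3) by (simp add: set_integrable_def)
  qed (use assms(1) in auto)
  then show ?thesis
    by (simp add: interval_lebesgue_integral_def set_lebesgue_integral_def)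
qed

text \<open>
  Integration by parts: \<open>cis (- (x * \<xi>)) * f x\<close> vanishes at both ends of the line.
\<close>
lemma fourier_integral_derivative:
  assumes deriv: "\<And>x. (f has_vector_derivative f' x) (at x)" and "continuous_on UNIV f'"
    and f: "integrable lborel f" and f': "integrable lborel f'"
    and "(f \<longlongrightarrow> 0) at_top" "(f \<longlongrightarrow> 0) at_bot"
  shows "fourier_integral f' \<xi> = \<i> * \<xi> * fourier_integral f \<xi>"
proof -
  let ?c = "\<lambda>x. cis (- (x * \<xi>))"
  have contf: "continuous_on UNIV f"
    using deriv by (meson continuous_at_imp_continuous_on has_vector_derivative_continuous)
  have int: "integrable lborel (\<lambda>x. ?c x * f x)" "integrable lborel (\<lambda>x. ?c x * f' x)"
    using integrable_cis_mult [OF f, of "-\<xi>"] integrable_cis_mult [OF f', of "-\<xi>"]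
    by (simp_all add: mult.commute)
  have "(LINT x|lborel. ?c x * f' x - \<i> * \<xi> * (?c x * f x)) = 0"
  proof (rule integral_derivative_eq_0)
    fix x
    have "((\<lambda>x. ?c x) has_vector_derivative (- \<xi> * (\<i> * ?c x))) (at x)"
      unfolding cis_conv_exp
      by (rule derivative_eq_intros has_vector_derivative_real_field | simp add: field_simps)+
    then have "((\<lambda>x. ?c x * f x) has_vector_derivative (?c x * f' x + (- \<xi> * (\<i> * ?c x)) * f x)) (at x)"
      by (intro has_vector_derivative_mult deriv)
    then show "((\<lambda>x. ?c x * f x) has_vector_derivative (?c x * f' x - \<i> * \<xi> * (?c x * f x))) (at x)"
      by (simp add: algebra_simps)
    show "continuous_on UNIV (\<lambda>x. ?c x * f' x - \<i> * \<xi> * (?c x * f x))"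
      by (intro continuous_intros contf assms)
    show "integrable lborel (\<lambda>x. ?c x * f' x - \<i> * \<xi> * (?c x * f x))"
      using int by simp
    show "((\<lambda>x. ?c x * f x) \<longlongrightarrow> 0) at_top" "((\<lambda>x. ?c x * f x) \<longlongrightarrow> 0) at_bot"
      by (rule tendsto_norm_zero_cancel, simp add: norm_mult tendsto_norm_zero assms(5,6))+
  qed
  then show ?thesis
    using int by (simp add: fourier_integral_def)
qed

text \<open>
  Integration by parts again; here the boundary terms vanish because the test function has compact support.
\<close>
lemma weak_deriv_of_derivative:
  assumes deriv: "\<And>x. (f has_vector_derivative f' x) (at x)" and cont': "continuous_on UNIV f'"
  shows "weak_deriv f f'"
  unfolding weak_deriv_def
proof (intro allI impI)
  fix \<psi> assume \<psi>: "test_function \<psi>"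
  then have smooth: "((deriv ^^ n) \<psi>) differentiable_on UNIV" for n
    by (simp add: test_function_def)
  have diff: "\<psi> differentiable_on UNIV" and diff': "deriv \<psi> differentiable_on UNIV"
    using smooth [of 0] smooth [of 1] by simp_all
  have comp: "compact (closure {x. \<psi> x \<noteq> 0})"
    using \<psi> by (simp add: test_function_def)
  have d\<psi>: "(\<psi> has_real_derivative deriv \<psi> x) (at x)" for x
    using diff by (simp add: DERIV_deriv_iff_real_differentiable differentiable_on_def)
  have cont: "continuous_on UNIV f"
    using deriv by (meson continuous_at_imp_continuous_on has_vector_derivative_continuous)
  have cont\<psi>: "continuous_on UNIV \<psi>" "continuous_on UNIV (deriv \<psi>)"
    using diff diff' by (auto intro: differentiable_imp_continuous_on)
  obtain R where "\<forall>x\<in>closure {x. \<psi> x \<noteq> 0}. norm x \<le> R"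
    using compact_imp_bounded [OF comp] unfolding bounded_iff by blast
  then have R: "\<bar>x\<bar> \<le> R" if "\<psi> x \<noteq> 0" for x
    using closure_subset [of "{x. \<psi> x \<noteq> 0}"] that by auto
  have zero: "\<psi> x = 0" "deriv \<psi> x = 0" if "\<bar>x\<bar> > R" for x
  proof -
    show "\<psi> x = 0" using R that by force
    have "open {x::real. \<bar>x\<bar> > R}"
      by (intro open_Collect_less continuous_intros)
    moreover have "\<psi> y = 0" if "y \<in> {x. \<bar>x\<bar> > R}" for y
      using R that by force
    ultimately have "(\<psi> has_real_derivative 0) (at x)"
      using that by (intro has_field_derivative_transform_within_open [OF DERIV_const [of 0]]) auto
    then show "deriv \<psi> x = 0"
      by (rule DERIV_imp_deriv)
  qed
  have int: "integrable lborel g" if "continuous_on UNIV g" "\<And>x. \<bar>x\<bar> > R \<Longrightarrow> g x = 0" for g :: "real \<Rightarrow> complex"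
  proof -
    have "set_integrable lborel {-R..R} g"
      by (rule borel_integrable_atLeastAtMost') (use that in \<open>auto intro: continuous_on_subset\<close>)
    moreover have "(\<lambda>x. indicator {-R..R} x *\<^sub>R g x) = g"
    proof
      fix x
      show "indicator {-R..R} x *\<^sub>R g x = g x"
        using that(2) [of x] by (cases "\<bar>x\<bar> > R") (auto simp: indicator_def)
    qed
    ultimately show ?thesis
      by (simp add: set_integrable_def)
  qed
  have int1: "integrable lborel (\<lambda>x. deriv \<psi> x *\<^sub>R f x)" and int2: "integrable lborel (\<lambda>x. \<psi> x *\<^sub>R f' x)"
    using zero by (auto intro!: int continuous_intros cont cont' cont\<psi>)
  have "(LINT x|lborel. \<psi> x *\<^sub>R f' x + deriv \<psi> x *\<^sub>R f x) = 0"
  proof (rule integral_derivative_eq_0)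
    show "((\<lambda>x. \<psi> x *\<^sub>R f x) has_vector_derivative \<psi> x *\<^sub>R f' x + deriv \<psi> x *\<^sub>R f x) (at x)" for x
      by (rule has_vector_derivative_scaleR [OF d\<psi> deriv])
    show "continuous_on UNIV (\<lambda>x. \<psi> x *\<^sub>R f' x + deriv \<psi> x *\<^sub>R f x)"
      by (intro continuous_intros cont cont' cont\<psi>)
    show "((\<lambda>x. \<psi> x *\<^sub>R f x) \<longlongrightarrow> 0) at_top"
      by (rule tendsto_eventually, rule eventually_mono [OF eventually_gt_at_top [of R]]) (use zero in auto)
    show "((\<lambda>x. \<psi> x *\<^sub>R f x) \<longlongrightarrow> 0) at_bot"
      by (rule tendsto_eventually, rule eventually_mono [OF eventually_gt_at_bot [of "-R"]]) (use zero in auto)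
  qed (use int1 int2 in auto)
  then show "(LINT x|lborel. deriv \<psi> x *\<^sub>R f x) = - (LINT x|lborel. \<psi> x *\<^sub>R f' x)"
    using int1 int2 by (simp add: eq_neg_iff_add_eq_0 add.commute)
qed

section \<open>The Fourier transform of square-integrable functions\<close>

lemma ennsqrt_square [simp]: "(ennsqrt x)\<^sup>2 = x"
proof (cases x)
  case (real r)
  then show ?thesis
    by (simp add: ennsqrt_def ennreal_power)
next
  case top
  then show ?thesis
    by (simp add: ennsqrt_def power2_eq_square)
qed

lemma L2_norm_square: "(L2_norm f)\<^sup>2 = (\<integral>\<^sup>+x. ennreal ((norm (f x))\<^sup>2) \<partial>lborel)"
  by (simp add: L2_norm_def)

lemma ennsqrt_ennreal: "x \<ge> 0 \<Longrightarrow> ennsqrt (ennreal x) = ennreal (sqrt x)"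
  by (simp add: ennsqrt_def)

lemma ennsqrt_mono: "x \<le> y \<Longrightarrow> ennsqrt x \<le> ennsqrt y"
  by (cases x; cases y) (auto simp: ennsqrt_def infinity_ennreal_def top_unique)

lemma L2_fun_nn_integral_finite:
  assumes "f \<in> L2_fun"
  shows "(\<integral>\<^sup>+x. ennreal ((norm (f x))\<^sup>2) \<partial>lborel) < \<infinity>"
  using assms unfolding L2_norm_square [symmetric] L2_fun_def
  by (simp add: power2_eq_square ennreal_mult_less_top)

lemma truncated_fourier_eq:
  "truncated_fourier f R \<xi>
    = complex_of_real (1 / sqrt (2 * pi)) * fourier_integral (\<lambda>x. indicator {-R..R} x *\<^sub>R f x) \<xi>"
  by (simp add: truncated_fourier_def fourier_integral_def set_lebesgue_integral_def mult_ac)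

lemma fourier_L2_nn_integral_tendsto:
  assumes "fourier_L2 f F"
  shows "((\<lambda>R. \<integral>\<^sup>+\<xi>. ennreal ((norm (truncated_fourier f R \<xi> - F \<xi>))\<^sup>2) \<partial>lborel) \<longlongrightarrow> 0) at_top"
proof -
  have *: "((\<lambda>R. L2_norm (\<lambda>\<xi>. truncated_fourier f R \<xi> - F \<xi>)) \<longlongrightarrow> 0) at_top"
    using assms by (simp add: fourier_L2_def)
  have "((\<lambda>R. L2_norm (\<lambda>\<xi>. truncated_fourier f R \<xi> - F \<xi>) * L2_norm (\<lambda>\<xi>. truncated_fourier f R \<xi> - F \<xi>))
      \<longlongrightarrow> 0 * 0) at_top"
    by (rule tendsto_mult_ennreal [OF * *]) simp
  then show ?thesis
    by (simp flip: power2_eq_square add: L2_norm_square)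
qed

text \<open>
  Truncation brings square-integrable functions into the reach of the Fourier integral:
  \<open>\<bar>f\<bar> \<le> 1 + \<bar>f\<bar>\<^sup>2\<close> on a bounded interval.
\<close>
lemma integrable_truncation:
  assumes "f \<in> L2_fun"
  shows "integrable lborel (\<lambda>x. indicator {-R..R} x *\<^sub>R f x)"
proof (rule Bochner_Integration.integrable_bound)
  have [measurable]: "f \<in> borel_measurable borel"
    using assms by (simp add: L2_fun_def)
  have "(\<integral>\<^sup>+x. ennreal ((norm (f x))\<^sup>2) \<partial>lborel) < \<infinity>"
    by (rule L2_fun_nn_integral_finite [OF assms])
  then have "integrable lborel (\<lambda>x. (norm (f x))\<^sup>2)"
    by (intro integrableI_bounded) auto
  then show "integrable lborel (\<lambda>x. indicator {-R..R} x + (norm (f x))\<^sup>2)"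
    by (intro Bochner_Integration.integrable_add) (auto simp: integrable_indicator_iff emeasure_lborel_Icc_eq)
  have "norm (f x) \<le> 1 + (norm (f x))\<^sup>2" for x
    using sum_squares_bound [of "norm (f x)" 1] norm_ge_zero [of "f x"] unfolding one_power2 by linarith
  then show "AE x in lborel. norm (indicator {-R..R} x *\<^sub>R f x)
      \<le> norm (indicator {-R..R} x + (norm (f x))\<^sup>2)"
    by (intro AE_I2) (auto simp: indicator_def)
  show "(\<lambda>x. indicator {-R..R} x *\<^sub>R f x) \<in> borel_measurable lborel"
    by measurable
qed

text \<open>
  A substitute for the triangle inequality in \<open>L\<^sup>2\<close>, which passes through nonnegative integrals term by
  term. The first factor can be taken arbitrarily close to one.
\<close>
lemma norm_square_le_weighted:
  fixes a b :: "'a::real_normed_vector"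
  assumes "\<delta> > 0"
  shows "(norm b)\<^sup>2 \<le> (1 + \<delta>) * (norm a)\<^sup>2 + (1 + 1 / \<delta>) * (norm (a - b))\<^sup>2"
proof -
  define u v where "u = norm a" and "v = norm (a - b)"
  have "norm b \<le> u + v"
    unfolding u_def v_def by (metis norm_minus_commute norm_triangle_sub)
  then have "(norm b)\<^sup>2 \<le> (u + v)\<^sup>2"
    by (intro power_mono) auto
  also have "\<dots> \<le> (1 + \<delta>) * u\<^sup>2 + (1 + 1 / \<delta>) * v\<^sup>2"
  proof -
    have "0 \<le> (\<delta> * u - v)\<^sup>2 / \<delta>"
      using assms by simp
    also have "\<dots> = (1 + \<delta>) * u\<^sup>2 + (1 + 1 / \<delta>) * v\<^sup>2 - (u + v)\<^sup>2"
      using assms by (simp add: field_simps power2_eq_square)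
    finally show ?thesis by simp
  qed
  finally show ?thesis by (simp add: u_def v_def)
qed

lemma nn_integral_truncated_fourier_le:
  assumes "f \<in> L2_fun"
  shows "(\<integral>\<^sup>+\<xi>. ennreal ((norm (truncated_fourier f R \<xi>))\<^sup>2) \<partial>lborel)
      \<le> (\<integral>\<^sup>+x. ennreal ((norm (f x))\<^sup>2) \<partial>lborel)"
proof -
  let ?t = "\<lambda>x. indicator {-R..R} x *\<^sub>R f x"
  have int: "integrable lborel ?t"
    by (rule integrable_truncation [OF assms])
  then have [measurable]: "?t \<in> borel_measurable lborel" by auto
  have "(\<integral>\<^sup>+\<xi>. ennreal ((norm (truncated_fourier f R \<xi>))\<^sup>2) \<partial>lborel)
      = (\<integral>\<^sup>+\<xi>. ennreal (1 / (2 * pi)) * ennreal ((norm (fourier_integral ?t \<xi>))\<^sup>2) \<partial>lborel)"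
    by (simp add: truncated_fourier_eq norm_mult norm_divide power_mult_distrib power_divide
        real_sqrt_pow2 flip: ennreal_mult)
  also have "\<dots> = ennreal (1 / (2 * pi)) * (\<integral>\<^sup>+\<xi>. ennreal ((norm (fourier_integral ?t \<xi>))\<^sup>2) \<partial>lborel)"
    by (rule nn_integral_cmult) measurable
  also have "\<dots> \<le> ennreal (1 / (2 * pi)) * (ennreal (2 * pi) * (\<integral>\<^sup>+x. ennreal ((norm (?t x))\<^sup>2) \<partial>lborel))"
    by (intro mult_left_mono plancherel_le int) auto
  also have "\<dots> = (\<integral>\<^sup>+x. ennreal ((norm (?t x))\<^sup>2) \<partial>lborel)"
    by (simp flip: mult.assoc ennreal_mult)
  also have "\<dots> \<le> (\<integral>\<^sup>+x. ennreal ((norm (f x))\<^sup>2) \<partial>lborel)"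
    by (intro nn_integral_mono ennreal_leI) (auto simp: indicator_def)
  finally show ?thesis .
qed

text \<open>
  The inequality holds for every truncated transform and survives the limit: for fixed \<open>\<delta>\<close> the distance to
  \<open>G\<close> disappears as \<open>R\<close> grows, and then \<open>\<delta>\<close> tends to \<open>0\<close>.
\<close>
lemma fourier_L2_nn_integral_le:
  assumes "fourier_L2 g G"
  shows "(\<integral>\<^sup>+\<xi>. ennreal ((norm (G \<xi>))\<^sup>2) \<partial>lborel) \<le> (\<integral>\<^sup>+x. ennreal ((norm (g x))\<^sup>2) \<partial>lborel)"
    (is "?G \<le> ?A")
proof -
  have g: "g \<in> L2_fun" and [measurable]: "G \<in> borel_measurable borel"
    using assms by (auto simp: fourier_L2_def L2_fun_def)
  have [measurable]: "truncated_fourier g R \<in> borel_measurable borel" for R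
    using integrable_truncation [OF g, of R, THEN borel_measurable_integrable]
    unfolding truncated_fourier_eq [abs_def] by measurable
  let ?e = "\<lambda>R. \<integral>\<^sup>+\<xi>. ennreal ((norm (truncated_fourier g R \<xi> - G \<xi>))\<^sup>2) \<partial>lborel"
  have *: "?G \<le> ennreal (1 + \<delta>) * ?A" if "\<delta> > 0" for \<delta>
  proof -
    have "?G \<le> ennreal (1 + \<delta>) * ?A + ennreal (1 + 1 / \<delta>) * ?e R" for R
    proof -
      have "?G \<le> (\<integral>\<^sup>+\<xi>. ennreal (1 + \<delta>) * ennreal ((norm (truncated_fourier g R \<xi>))\<^sup>2)
          + ennreal (1 + 1 / \<delta>) * ennreal ((norm (truncated_fourier g R \<xi> - G \<xi>))\<^sup>2) \<partial>lborel)"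
        using \<open>\<delta> > 0\<close>
        by (intro nn_integral_mono)
           (auto intro!: ennreal_leI norm_square_le_weighted simp flip: ennreal_mult ennreal_plus)
      also have "\<dots> = ennreal (1 + \<delta>) * (\<integral>\<^sup>+\<xi>. ennreal ((norm (truncated_fourier g R \<xi>))\<^sup>2) \<partial>lborel)
          + ennreal (1 + 1 / \<delta>) * ?e R"
        by (simp add: nn_integral_add nn_integral_cmult)
      also have "\<dots> \<le> ennreal (1 + \<delta>) * ?A + ennreal (1 + 1 / \<delta>) * ?e R"
        by (intro add_mono mult_left_mono nn_integral_truncated_fourier_le g) auto
      finally show ?thesis .
    qed
    moreover have "((\<lambda>R. ennreal (1 + \<delta>) * ?A + ennreal (1 + 1 / \<delta>) * ?e R)
        \<longlongrightarrow> ennreal (1 + \<delta>) * ?A + ennreal (1 + 1 / \<delta>) * 0) at_top"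
      by (intro tendsto_add tendsto_const ennreal_tendsto_cmult fourier_L2_nn_integral_tendsto assms)
         auto
    ultimately show ?thesis
      by (intro tendsto_lowerbound [where F = at_top]) auto
  qed
  have "?A < \<infinity>"
    by (rule L2_fun_nn_integral_finite [OF g])
  then have "((\<lambda>\<delta>. ennreal (1 + \<delta>) * ?A) \<longlongrightarrow> ennreal (1 + 0) * ?A) (at_right 0)"
    by (intro tendsto_mult_ennreal tendsto_ennrealI tendsto_intros) auto
  moreover have "\<forall>\<^sub>F \<delta> in at_right 0. ?G \<le> ennreal (1 + \<delta>) * ?A"
    using * by (auto simp: eventually_at_right_less intro: eventually_mono [OF eventually_at_right_less])
  ultimately show ?thesis
    by (intro tendsto_lowerbound [where F = "at_right (0::real)"]) auto
qed

text \<open>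
  The truncated transforms converge to \<open>F\<close> in \<open>L\<^sup>2\<close> and, by dominated convergence, pointwise to the Fourier
  integral. Fatou's lemma identifies the two limits without passing to a subsequence.
\<close>
lemma fourier_L2_AE_eq:
  assumes "fourier_L2 f F" and f: "integrable lborel f"
  shows "AE \<xi> in lborel. F \<xi> = complex_of_real (1 / sqrt (2 * pi)) * fourier_integral f \<xi>"
proof -
  have g: "f \<in> L2_fun" and [measurable]: "F \<in> borel_measurable borel" "f \<in> borel_measurable borel"
    using assms by (auto simp: fourier_L2_def L2_fun_def)
  have [measurable]: "truncated_fourier f R \<in> borel_measurable borel" for R
    using integrable_truncation [OF g, of R, THEN borel_measurable_integrable]
    unfolding truncated_fourier_eq [abs_def] by measurable
  let ?h = "\<lambda>\<xi>. complex_of_real (1 / sqrt (2 * pi)) * fourier_integral f \<xi>"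
  have lim: "(\<lambda>n. truncated_fourier f (real n) \<xi>) \<longlonglongrightarrow> ?h \<xi>" for \<xi>
    unfolding truncated_fourier_eq
  proof (rule tendsto_mult_left)
    show "(\<lambda>n. fourier_integral (\<lambda>x. indicator {- real n..real n} x *\<^sub>R f x) \<xi>) \<longlonglongrightarrow> fourier_integral f \<xi>"
      unfolding fourier_integral_def
    proof (rule integral_dominated_convergence)
      show "integrable lborel (\<lambda>x. norm (f x))"
        using f by simp
      show "AE x in lborel. (\<lambda>n. cis (- (x * \<xi>)) * indicator {- real n..real n} x *\<^sub>R f x)
          \<longlonglongrightarrow> cis (- (x * \<xi>)) * f x"
      proof (intro AE_I2 tendsto_eventually)
        fix x :: real
        have "\<forall>\<^sub>F n in sequentially. \<bar>x\<bar> \<le> real n"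
          using real_arch_simple [of "\<bar>x\<bar>"] 
          by (meson eventually_sequentiallyI le_trans of_nat_le_iff order.trans)
        then show "\<forall>\<^sub>F n in sequentially. cis (- (x * \<xi>)) * indicator {- real n..real n} x *\<^sub>R f x
            = cis (- (x * \<xi>)) * f x"
          by eventually_elim (auto simp: indicator_def)
      qed
      show "AE x in lborel. norm (cis (- (x * \<xi>)) * indicator {- real n..real n} x *\<^sub>R f x)
          \<le> norm (f x)" for n
        by (intro AE_I2) (auto simp: norm_mult indicator_def)
    qed measurable
  qed
  let ?e = "\<lambda>n \<xi>. ennreal ((norm (truncated_fourier f (real n) \<xi> - F \<xi>))\<^sup>2)"
  have "(\<lambda>n. ?e n \<xi>) \<longlonglongrightarrow> ennreal ((norm (?h \<xi> - F \<xi>))\<^sup>2)" for \<xi>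
    by (intro tendsto_ennrealI tendsto_intros lim)
  then have "liminf (\<lambda>n. ?e n \<xi>) = ennreal ((norm (?h \<xi> - F \<xi>))\<^sup>2)" for \<xi>
    by (intro lim_imp_Liminf) auto
  then have "(\<integral>\<^sup>+\<xi>. ennreal ((norm (?h \<xi> - F \<xi>))\<^sup>2) \<partial>lborel) = (\<integral>\<^sup>+\<xi>. liminf (\<lambda>n. ?e n \<xi>) \<partial>lborel)"
    by simp
  also have "\<dots> \<le> liminf (\<lambda>n. \<integral>\<^sup>+\<xi>. ?e n \<xi> \<partial>lborel)"
    by (rule nn_integral_liminf) measurable
  also have "\<dots> = 0"
    by (intro lim_imp_Liminf filterlim_compose [OF fourier_L2_nn_integral_tendsto [OF assms(1)]]
        filterlim_real_sequentially) auto
  finally have "AE \<xi> in lborel. ennreal ((norm (?h \<xi> - F \<xi>))\<^sup>2) = 0"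
    by (subst (asm) le_zero_eq, subst (asm) nn_integral_0_iff_AE) auto
  then show ?thesis
    by eventually_elim simp
qed

section \<open>Interpolation between derivatives\<close>

text \<open>
  Together with the next lemma this replaces the full description of derivatives on the Fourier side. A
  lower bound for a moment needs the harder half of Plancherel's theorem, hence a bounded continuous derivative.
\<close>
lemma fourier_L2_derivative_ge:
  assumes F: "fourier_L2 f F"
    and deriv: "\<And>x. (f has_vector_derivative f1 x) (at x)" and cont: "continuous_on UNIV f1"
    and int: "integrable lborel f" "integrable lborel f1"
    and lim: "(f \<longlongrightarrow> 0) at_top" "(f \<longlongrightarrow> 0) at_bot"
    and bound: "\<And>x. norm (f1 x) \<le> B"
  shows "(\<integral>\<^sup>+x. ennreal ((norm (f1 x))\<^sup>2) \<partial>lborel)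
    \<le> (\<integral>\<^sup>+\<xi>. ennreal (\<xi>\<^sup>2 * (norm (F \<xi>))\<^sup>2) \<partial>lborel)"
proof -
  have [measurable]: "F \<in> borel_measurable borel"
    using F by (simp add: fourier_L2_def L2_fun_def)
  have "ennreal (2 * pi) * (\<integral>\<^sup>+x. ennreal ((norm (f1 x))\<^sup>2) \<partial>lborel)
      \<le> (\<integral>\<^sup>+\<xi>. ennreal ((norm (fourier_integral f1 \<xi>))\<^sup>2) \<partial>lborel)"
    by (rule plancherel_ge [OF int(2) cont bound])
  also have "\<dots> = (\<integral>\<^sup>+\<xi>. ennreal (2 * pi) * ennreal (\<xi>\<^sup>2 * (norm (F \<xi>))\<^sup>2) \<partial>lborel)"
  proof (rule nn_integral_cong_AE)
    show "AE \<xi> in lborel. ennreal ((norm (fourier_integral f1 \<xi>))\<^sup>2)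
        = ennreal (2 * pi) * ennreal (\<xi>\<^sup>2 * (norm (F \<xi>))\<^sup>2)"
      using fourier_L2_AE_eq [OF F int(1)]
      by eventually_elim
         (simp add: fourier_integral_derivative [OF deriv cont int lim] norm_mult norm_divide
          power_mult_distrib power_divide real_sqrt_pow2 flip: ennreal_mult)
  qed
  also have "\<dots> = ennreal (2 * pi) * (\<integral>\<^sup>+\<xi>. ennreal (\<xi>\<^sup>2 * (norm (F \<xi>))\<^sup>2) \<partial>lborel)"
    by (rule nn_integral_cmult) measurable
  finally show ?thesis
    by (subst (asm) ennreal_mult_le_mult_iff) auto
qed

lemma fourier_L2_second_derivative_le:
  assumes F: "fourier_L2 f F"
    and deriv: "\<And>x. (f has_vector_derivative f1 x) (at x)" "\<And>x. (f1 has_vector_derivative f2 x) (at x)"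
    and cont: "continuous_on UNIV f2"
    and int: "integrable lborel f" "integrable lborel f1" "integrable lborel f2"
    and lim: "(f \<longlongrightarrow> 0) at_top" "(f \<longlongrightarrow> 0) at_bot"
    and lim1: "(f1 \<longlongrightarrow> 0) at_top" "(f1 \<longlongrightarrow> 0) at_bot"
  shows "(\<integral>\<^sup>+\<xi>. ennreal (\<xi> ^ 4 * (norm (F \<xi>))\<^sup>2) \<partial>lborel)
    \<le> (\<integral>\<^sup>+x. ennreal ((norm (f2 x))\<^sup>2) \<partial>lborel)"
proof -
  have [measurable]: "F \<in> borel_measurable borel"
    using F by (simp add: fourier_L2_def L2_fun_def)
  have cont1: "continuous_on UNIV f1"
    using deriv(2) by (meson continuous_at_imp_continuous_on has_vector_derivative_continuous)
  have "ennreal (2 * pi) * (\<integral>\<^sup>+\<xi>. ennreal (\<xi> ^ 4 * (norm (F \<xi>))\<^sup>2) \<partial>lborel)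
      = (\<integral>\<^sup>+\<xi>. ennreal (2 * pi) * ennreal (\<xi> ^ 4 * (norm (F \<xi>))\<^sup>2) \<partial>lborel)"
    by (rule nn_integral_cmult [symmetric]) measurable
  also have "\<dots> = (\<integral>\<^sup>+\<xi>. ennreal ((norm (fourier_integral f2 \<xi>))\<^sup>2) \<partial>lborel)"
  proof (rule nn_integral_cong_AE)
    show "AE \<xi> in lborel. ennreal (2 * pi) * ennreal (\<xi> ^ 4 * (norm (F \<xi>))\<^sup>2)
        = ennreal ((norm (fourier_integral f2 \<xi>))\<^sup>2)"
      using fourier_L2_AE_eq [OF F int(1)]
    proof eventually_elim
      case (elim \<xi>)
      have "fourier_integral f2 \<xi> = \<i> * \<xi> * (\<i> * \<xi> * fourier_integral f \<xi>)"
        using fourier_integral_derivative [OF deriv(2) cont int(2,3) lim1]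
          fourier_integral_derivative [OF deriv(1) cont1 int(1,2) lim] by simp
      then have "(norm (fourier_integral f2 \<xi>))\<^sup>2 = 2 * pi * (\<xi> ^ 4 * (norm (F \<xi>))\<^sup>2)"
        unfolding elim by (simp add: norm_mult norm_divide power_mult_distrib power_divide flip: power_mult)
      then show ?case
        by (simp flip: ennreal_mult)
    qed
  qed
  also have "\<dots> \<le> ennreal (2 * pi) * (\<integral>\<^sup>+x. ennreal ((norm (f2 x))\<^sup>2) \<partial>lborel)"
    by (rule plancherel_le [OF int(3)])
  finally show ?thesis
    by (subst (asm) ennreal_mult_le_mult_iff) auto
qed

text \<open>
  Below the threshold \<open>\<xi>\<^sup>2 \<le> L\<close> the first term alone suffices, above it the second one does. The coefficient
  of \<open>\<xi> ^ 4\<close> becomes small when \<open>L\<close> is large, which makes absorption possible.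
\<close>
lemma square_le_powr_plus_fourth:
  fixes \<xi> L s :: real
  assumes "L > 0" "0 \<le> s" "s \<le> 1"
  shows "\<xi>\<^sup>2 \<le> L powr (1 - s) * (\<bar>\<xi>\<bar> powr s)\<^sup>2 + \<xi> ^ 4 / L"
proof (cases "\<xi>\<^sup>2 \<le> L")
  case True
  show ?thesis
  proof (cases "\<xi> = 0")
    case False
    then have pos: "\<xi>\<^sup>2 > 0" by simp
    have "(\<bar>\<xi>\<bar> powr s)\<^sup>2 = (\<xi>\<^sup>2) powr s"
      using False by (simp add: power2_eq_square abs_mult flip: powr_mult)
    moreover have "\<xi>\<^sup>2 = (\<xi>\<^sup>2) powr (1 - s) * (\<xi>\<^sup>2) powr s"
      using pos by (simp flip: powr_add)
    moreover have "(\<xi>\<^sup>2) powr (1 - s) \<le> L powr (1 - s)"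
      using True assms by (intro powr_mono2) auto
    ultimately have "\<xi>\<^sup>2 \<le> L powr (1 - s) * (\<bar>\<xi>\<bar> powr s)\<^sup>2"
      by (metis mult_right_mono powr_ge_zero)
    moreover have "0 \<le> \<xi> ^ 4 / L"
      using assms by simp
    ultimately show ?thesis by linarith
  qed (use assms in simp)
next
  case False
  have "\<xi>\<^sup>2 * L \<le> \<xi>\<^sup>2 * \<xi>\<^sup>2"
    using False by (intro mult_left_mono) auto
  also have "\<xi>\<^sup>2 * \<xi>\<^sup>2 = \<xi> ^ 4"
    by (simp flip: power_add)
  finally have "\<xi>\<^sup>2 \<le> \<xi> ^ 4 / L"
    using assms by (simp add: field_simps)
  moreover have "0 \<le> L powr (1 - s) * (\<bar>\<xi>\<bar> powr s)\<^sup>2" by simp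
  ultimately show ?thesis by linarith
qed

text \<open>
  The pointwise inequality is integrated against \<open>\<bar>F\<bar>\<^sup>2\<close> with the threshold \<open>L = 2 * M\<^sup>2 * \<omega>\<close>. This
  choice makes the contribution of the fourth moment at most half of the second moment.
\<close>
lemma weighted_norm_lower_bound:
  fixes F :: "real \<Rightarrow> complex"
  assumes [measurable]: "F \<in> borel_measurable borel"
    and "\<omega> > 0" "M > 0" "0 \<le> s" "s \<le> 1" "a \<ge> 0" and \<alpha>: "a * \<omega> powr (-s) \<le> \<alpha>"
    and two: "ennreal (\<omega> * \<alpha>) \<le> (\<integral>\<^sup>+\<xi>. ennreal (\<xi>\<^sup>2 * (norm (F \<xi>))\<^sup>2) \<partial>lborel)"
    and four: "(\<integral>\<^sup>+\<xi>. ennreal (\<xi> ^ 4 * (norm (F \<xi>))\<^sup>2) \<partial>lborel) \<le> ennreal ((M * \<omega>)\<^sup>2 * \<alpha>)"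
  shows "ennreal (a / (2 * (2 * M\<^sup>2) powr (1 - s)))
    \<le> (\<integral>\<^sup>+\<xi>. ennreal ((norm (complex_of_real (\<bar>\<xi>\<bar> powr s) * F \<xi>))\<^sup>2) \<partial>lborel)" (is "_ \<le> ?B")
proof (cases ?B)
  case (real b)
  define L where "L = 2 * M\<^sup>2 * \<omega>"
  have "L > 0"
    using assms by (simp add: L_def)
  have "\<alpha> \<ge> 0"
    using \<alpha> mult_nonneg_nonneg [OF \<open>a \<ge> 0\<close> powr_ge_zero [of \<omega> "-s"]] by linarith
  have "ennreal (\<omega> * \<alpha>) \<le> (\<integral>\<^sup>+\<xi>. ennreal (\<xi>\<^sup>2 * (norm (F \<xi>))\<^sup>2) \<partial>lborel)"
    by (rule two)
  also have "\<dots> \<le> (\<integral>\<^sup>+\<xi>. ennreal (L powr (1 - s)) * ennreal ((norm (complex_of_real (\<bar>\<xi>\<bar> powr s) * F \<xi>))\<^sup>2)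
      + ennreal (1 / L) * ennreal (\<xi> ^ 4 * (norm (F \<xi>))\<^sup>2) \<partial>lborel)"
  proof (intro nn_integral_mono)
    fix \<xi>
    have "\<xi>\<^sup>2 * (norm (F \<xi>))\<^sup>2
        \<le> (L powr (1 - s) * (\<bar>\<xi>\<bar> powr s)\<^sup>2 + \<xi> ^ 4 / L) * (norm (F \<xi>))\<^sup>2"
      using square_le_powr_plus_fourth [OF \<open>L > 0\<close>] assms by (intro mult_right_mono) auto
    then have "\<xi>\<^sup>2 * (norm (F \<xi>))\<^sup>2
        \<le> L powr (1 - s) * (norm (complex_of_real (\<bar>\<xi>\<bar> powr s) * F \<xi>))\<^sup>2 + 1 / L * (\<xi> ^ 4 * (norm (F \<xi>))\<^sup>2)"
      by (simp add: norm_mult power_mult_distrib algebra_simps)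
    then show "ennreal (\<xi>\<^sup>2 * (norm (F \<xi>))\<^sup>2)
        \<le> ennreal (L powr (1 - s)) * ennreal ((norm (complex_of_real (\<bar>\<xi>\<bar> powr s) * F \<xi>))\<^sup>2)
          + ennreal (1 / L) * ennreal (\<xi> ^ 4 * (norm (F \<xi>))\<^sup>2)"
      using \<open>L > 0\<close> by (simp add: ennreal_leI flip: ennreal_mult ennreal_plus del: of_real_power)
  qed
  also have "\<dots> = ennreal (L powr (1 - s)) * ?B
      + ennreal (1 / L) * (\<integral>\<^sup>+\<xi>. ennreal (\<xi> ^ 4 * (norm (F \<xi>))\<^sup>2) \<partial>lborel)"
    by (simp add: nn_integral_add nn_integral_cmult)
  also have "\<dots> \<le> ennreal (L powr (1 - s)) * ennreal b + ennreal (1 / L) * ennreal ((M * \<omega>)\<^sup>2 * \<alpha>)"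
    unfolding real by (intro add_mono mult_left_mono four) auto
  also have "\<dots> = ennreal (L powr (1 - s) * b + 1 / L * ((M * \<omega>)\<^sup>2 * \<alpha>))"
    using \<open>L > 0\<close> \<open>b \<ge> 0\<close> \<open>\<alpha> \<ge> 0\<close> by (simp flip: ennreal_mult ennreal_plus)
  also have "1 / L * ((M * \<omega>)\<^sup>2 * \<alpha>) = \<omega> * \<alpha> / 2"
    using assms by (simp add: L_def field_simps power2_eq_square)
  finally have "\<omega> * \<alpha> \<le> L powr (1 - s) * b + \<omega> * \<alpha> / 2"
    using \<open>\<omega> > 0\<close> \<open>b \<ge> 0\<close> \<open>\<alpha> \<ge> 0\<close> by (subst (asm) ennreal_le_iff) auto
  moreover have "L powr (1 - s) = (2 * M\<^sup>2) powr (1 - s) * \<omega> powr (1 - s)"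
    unfolding L_def using \<open>\<omega> > 0\<close> by (subst powr_mult) auto
  ultimately have "\<omega> * \<alpha> \<le> 2 * (2 * M\<^sup>2) powr (1 - s) * b * \<omega> powr (1 - s)"
    by (simp add: mult_ac)
  moreover have "a * \<omega> powr (1 - s) = \<omega> * (a * \<omega> powr (-s))"
    using \<open>\<omega> > 0\<close> by (simp add: powr_diff powr_minus divide_inverse)
  moreover have "\<omega> * (a * \<omega> powr (-s)) \<le> \<omega> * \<alpha>"
    using \<alpha> \<open>\<omega> > 0\<close> by simp
  ultimately have "a * \<omega> powr (1 - s) \<le> 2 * (2 * M\<^sup>2) powr (1 - s) * b * \<omega> powr (1 - s)"
    by linarith
  then have "a \<le> 2 * (2 * M\<^sup>2) powr (1 - s) * b"
    using \<open>\<omega> > 0\<close> by simp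
  then have "a / (2 * (2 * M\<^sup>2) powr (1 - s)) \<le> b"
    using \<open>M > 0\<close> by (simp add: field_simps)
  then show ?thesis
    unfolding real by (rule ennreal_leI)
qed simp

text \<open>
  If \<open>f\<close> oscillates at frequency \<open>sqrt \<omega>\<close>, as measured by its first two derivatives, then each homogeneous
  norm of order \<open>s\<close> in the unit interval is at least a multiple of \<open>\<omega> powr (s / 2)\<close> times the \<open>L\<^sup>2\<close> norm.
  A lower bound \<open>a * \<omega> powr (- s)\<close> for the squared \<open>L\<^sup>2\<close> norm cancels this power, and \<open>\<omega>\<close> disappears
  from the conclusion.
\<close>
lemma hom_sobolev_norm_ge:
  assumes deriv: "\<And>x. (f has_vector_derivative f1 x) (at x)" "\<And>x. (f1 has_vector_derivative f2 x) (at x)"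
    and cont: "continuous_on UNIV f2"
    and int: "integrable lborel f" "integrable lborel f1" "integrable lborel f2"
    and lim: "(f \<longlongrightarrow> 0) at_top" "(f \<longlongrightarrow> 0) at_bot"
    and lim1: "(f1 \<longlongrightarrow> 0) at_top" "(f1 \<longlongrightarrow> 0) at_bot"
    and bound: "\<And>x. norm (f1 x) \<le> B"
    and f1: "\<And>x. norm (f1 x) = sqrt \<omega> * norm (f x)"
    and f2: "\<And>x. norm (f2 x) \<le> M * \<omega> * norm (f x)"
    and "\<omega> > 0" "M > 0" "0 \<le> s" "s \<le> 1" "a \<ge> 0"
    and lower: "ennreal (a * \<omega> powr (-s)) \<le> (\<integral>\<^sup>+x. ennreal ((norm (f x))\<^sup>2) \<partial>lborel)"
  shows "ennreal (sqrt (a / (2 * (2 * M\<^sup>2) powr (1 - s)))) \<le> hom_sobolev_norm s f"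
  unfolding hom_sobolev_norm_def
proof (rule INF_greatest)
  fix g assume "g \<in> {g. frac_deriv s f g}"
  then obtain F where F: "fourier_L2 f F"
    and g: "fourier_L2 g (\<lambda>\<xi>. complex_of_real (\<bar>\<xi>\<bar> powr s) * F \<xi>)"
    by (auto simp: frac_deriv_def)
  have "f \<in> L2_fun" and F_meas: "F \<in> borel_measurable borel"
    using F by (auto simp: fourier_L2_def L2_fun_def)
  then have [measurable]: "f \<in> borel_measurable borel"
    by (simp add: L2_fun_def)
  have "(\<integral>\<^sup>+x. ennreal ((norm (f x))\<^sup>2) \<partial>lborel) < \<infinity>"
    by (rule L2_fun_nn_integral_finite [OF \<open>f \<in> L2_fun\<close>])
  then obtain \<alpha> where "\<alpha> \<ge> 0" and \<alpha>: "(\<integral>\<^sup>+x. ennreal ((norm (f x))\<^sup>2) \<partial>lborel) = ennreal \<alpha>"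
    by (cases "\<integral>\<^sup>+x. ennreal ((norm (f x))\<^sup>2) \<partial>lborel") auto
  have "ennreal (\<omega> * \<alpha>) = (\<integral>\<^sup>+x. ennreal \<omega> * ennreal ((norm (f x))\<^sup>2) \<partial>lborel)"
    using \<open>\<omega> > 0\<close> \<open>\<alpha> \<ge> 0\<close> by (subst nn_integral_cmult) (auto simp: \<alpha> ennreal_mult)
  also have "\<dots> = (\<integral>\<^sup>+x. ennreal ((norm (f1 x))\<^sup>2) \<partial>lborel)"
    using \<open>\<omega> > 0\<close> by (simp add: f1 power_mult_distrib flip: ennreal_mult)
  also have "\<dots> \<le> (\<integral>\<^sup>+\<xi>. ennreal (\<xi>\<^sup>2 * (norm (F \<xi>))\<^sup>2) \<partial>lborel)"
    using deriv(2) by (intro fourier_L2_derivative_ge [OF F deriv(1) _ int(1,2) lim bound])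
      (meson continuous_at_imp_continuous_on has_vector_derivative_continuous)
  finally have two: "ennreal (\<omega> * \<alpha>) \<le> (\<integral>\<^sup>+\<xi>. ennreal (\<xi>\<^sup>2 * (norm (F \<xi>))\<^sup>2) \<partial>lborel)" .
  have "(\<integral>\<^sup>+\<xi>. ennreal (\<xi> ^ 4 * (norm (F \<xi>))\<^sup>2) \<partial>lborel) \<le> (\<integral>\<^sup>+x. ennreal ((norm (f2 x))\<^sup>2) \<partial>lborel)"
    by (rule fourier_L2_second_derivative_le [OF F deriv cont int lim lim1])
  also have "\<dots> \<le> (\<integral>\<^sup>+x. ennreal ((M * \<omega>)\<^sup>2) * ennreal ((norm (f x))\<^sup>2) \<partial>lborel)"
  proof (intro nn_integral_mono)
    fix x
    have "(norm (f2 x))\<^sup>2 \<le> (M * \<omega> * norm (f x))\<^sup>2"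
      by (intro power_mono f2) auto
    then show "ennreal ((norm (f2 x))\<^sup>2) \<le> ennreal ((M * \<omega>)\<^sup>2) * ennreal ((norm (f x))\<^sup>2)"
      by (simp add: power_mult_distrib ennreal_leI flip: ennreal_mult)
  qed
  also have "\<dots> = ennreal ((M * \<omega>)\<^sup>2 * \<alpha>)"
    using \<open>\<alpha> \<ge> 0\<close> by (subst nn_integral_cmult) (auto simp: \<alpha> ennreal_mult)
  finally have four: "(\<integral>\<^sup>+\<xi>. ennreal (\<xi> ^ 4 * (norm (F \<xi>))\<^sup>2) \<partial>lborel) \<le> ennreal ((M * \<omega>)\<^sup>2 * \<alpha>)" .
  have "a * \<omega> powr (-s) \<le> \<alpha>"
    using lower \<open>\<alpha> \<ge> 0\<close> by (simp add: \<alpha>)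
  then have "ennreal (a / (2 * (2 * M\<^sup>2) powr (1 - s)))
      \<le> (\<integral>\<^sup>+\<xi>. ennreal ((norm (complex_of_real (\<bar>\<xi>\<bar> powr s) * F \<xi>))\<^sup>2) \<partial>lborel)"
    by (intro weighted_norm_lower_bound [OF F_meas _ _ _ _ _ _ two four] assms)
  also have "\<dots> \<le> (\<integral>\<^sup>+x. ennreal ((norm (g x))\<^sup>2) \<partial>lborel)"
    by (rule fourier_L2_nn_integral_le [OF g])
  finally have "ennsqrt (ennreal (a / (2 * (2 * M\<^sup>2) powr (1 - s)))) \<le> L2_norm g"
    unfolding L2_norm_def by (rule ennsqrt_mono)
  then show "ennreal (sqrt (a / (2 * (2 * M\<^sup>2) powr (1 - s)))) \<le> L2_norm g"
    using \<open>a \<ge> 0\<close> by (simp add: ennsqrt_def)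
qed

section \<open>Exponential decay and primitives\<close>

text \<open>
  Near a given point only the part of the integral over a compact interval varies, and there the fundamental
  theorem of calculus for the gauge integral applies.
\<close>
lemma has_real_derivative_integral_atMost:
  fixes q :: "real \<Rightarrow> real"
  assumes cont: "continuous_on UNIV q" and int: "integrable lborel q"
  shows "((\<lambda>x. LINT y:{..x}|lborel. q y) has_real_derivative q x) (at x)"
proof -
  define a b where "a = x - 1" and "b = x + 1"
  have set_int: "set_integrable lborel A q" if "A \<in> sets borel" for A
    using int that unfolding set_integrable_def by (intro integrable_mult_indicator) auto
  have "((\<lambda>u. integral {a..u} q) has_vector_derivative q x) (at x within {a..b})"
    by (rule integral_has_vector_derivative) (use cont in \<open>auto simp: a_def b_def intro: continuous_on_subset\<close>)
  then have "((\<lambda>u. integral {a..u} q) has_real_derivative q x) (at x)"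
    by (simp add: has_real_derivative_iff_has_vector_derivative at_within_Icc_at a_def b_def)
  then have "((\<lambda>u. (LINT y:{..a}|lborel. q y) + integral {a..u} q) has_real_derivative q x) (at x)"
    using DERIV_add [OF DERIV_const] by fastforce
  then show ?thesis
  proof (rule has_field_derivative_transform_within_open [where S = "{a<..<b}"])
    fix u assume "u \<in> {a<..<b}"
    then have "{..u} = {..a} \<union> {a<..u}" by auto
    then have "(LINT y:{..u}|lborel. q y) = (LINT y:{..a}|lborel. q y) + (LINT y:{a<..u}|lborel. q y)"
      by (simp only:) (rule set_integral_Un; auto intro: set_int)
    also have "(LINT y:{a<..u}|lborel. q y) = integral {a<..u} q"
      by (rule set_borel_integral_eq_integral) (auto intro: set_int)
    also have "\<dots> = integral {a..u} q"
      by (rule integral_subset_negligible [of "{a<..u}" "{a..u}"])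
         (auto intro: negligible_subset [of "{a}"])
    finally show "(LINT y:{..a}|lborel. q y) + integral {a..u} q = (LINT y:{..u}|lborel. q y)"
      by simp
  qed (auto simp: a_def b_def)
qed

lemma nn_integral_exp_abs:
  assumes "a > 0"
  shows "(\<integral>\<^sup>+x. ennreal (exp (- a * \<bar>x\<bar>)) \<partial>lborel) = ennreal (2 / a)"
proof -
  let ?h = "\<lambda>x::real. ennreal (exp (- a * x)) * indicator {0..} x"
  have half: "(\<integral>\<^sup>+x. ?h x \<partial>lborel) = ennreal (0 - (- exp (- a * 0) / a))"
  proof (rule nn_integral_FTC_atLeast)
    fix x
    show "((\<lambda>x. - exp (- a * x) / a) has_real_derivative exp (- a * x)) (at x)"
      using assms by (auto intro!: derivative_eq_intros)
    have "((\<lambda>x. exp (- a * x)) \<longlongrightarrow> 0) at_top"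
      using assms by (intro filterlim_compose [OF exp_at_bot] filterlim_tendsto_neg_mult_at_bot [OF tendsto_const])
        (auto simp: filterlim_ident)
    then show "((\<lambda>x. - exp (- a * x) / a) \<longlongrightarrow> 0) at_top"
      using tendsto_divide_zero [of "\<lambda>x. - exp (- a * x)"] tendsto_minus [of "\<lambda>x. exp (- a * x)" 0] by simp
  qed auto
  have "(\<integral>\<^sup>+x. ennreal (exp (- a * \<bar>x\<bar>)) \<partial>lborel) = (\<integral>\<^sup>+x. ?h x + ?h (- x) \<partial>lborel)"
  proof (rule nn_integral_cong_AE)
    have "AE x in lborel. x \<noteq> (0::real)"
      by (rule AE_lborel_singleton)
    then show "AE x in lborel. ennreal (exp (- a * \<bar>x\<bar>)) = ?h x + ?h (- x)"
      by eventually_elim (auto simp: indicator_def)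
  qed
  also have "\<dots> = (\<integral>\<^sup>+x. ?h x \<partial>lborel) + (\<integral>\<^sup>+x. ?h (- x) \<partial>lborel)"
    by (rule nn_integral_add) auto
  also have "(\<integral>\<^sup>+x. ?h (- x) \<partial>lborel) = (\<integral>\<^sup>+x. ?h x \<partial>lborel)"
    using nn_integral_real_affine [of ?h "-1" 0] by simp
  also have "(\<integral>\<^sup>+x. ?h x \<partial>lborel) = ennreal (1 / a)"
    using half by simp
  also have "ennreal (1 / a) + ennreal (1 / a) = ennreal (2 / a)"
    using assms by (simp flip: ennreal_plus)
  finally show ?thesis .
qed

lemma integrable_exp_decay:
  fixes f :: "real \<Rightarrow> 'a::{banach, second_countable_topology}"
  assumes "a > 0" and cont: "continuous_on UNIV f" and bound: "\<And>x. norm (f x) \<le> K * exp (- a * \<bar>x\<bar>)"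
  shows "integrable lborel f"
proof (rule Bochner_Integration.integrable_bound)
  have "integrable lborel (\<lambda>x::real. exp (- a * \<bar>x\<bar>))"
    by (rule integrableI_bounded) (use nn_integral_exp_abs [OF \<open>a > 0\<close>] in auto)
  then show "integrable lborel (\<lambda>x::real. K * exp (- a * \<bar>x\<bar>))"
    by simp
  show "f \<in> borel_measurable lborel"
    using borel_measurable_continuous_onI [OF cont] by simp
  show "AE x in lborel. norm (f x) \<le> norm (K * exp (- a * \<bar>x\<bar>))"
    using bound by (intro AE_I2) (auto intro: order.trans [OF _ abs_ge_self])
qed

lemma tendsto_0_exp_decay:
  fixes f :: "real \<Rightarrow> 'a::real_normed_vector"
  assumes "a > 0" and bound: "\<And>x. norm (f x) \<le> K * exp (- a * \<bar>x\<bar>)"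
  shows "(f \<longlongrightarrow> 0) at_top" "(f \<longlongrightarrow> 0) at_bot"
proof -
  have top: "((\<lambda>x. K * exp (- a * \<bar>x\<bar>)) \<longlongrightarrow> 0) F" if "filterlim (\<lambda>x. \<bar>x\<bar>) at_top F" for F
  proof -
    have "filterlim (\<lambda>x. - a * \<bar>x\<bar>) at_bot F"
      using assms that by (intro filterlim_tendsto_neg_mult_at_bot [OF tendsto_const]) auto
    then have "((\<lambda>x. exp (- a * \<bar>x\<bar>)) \<longlongrightarrow> 0) F"
      by (rule filterlim_compose [OF exp_at_bot])
    then show ?thesis
      by (rule tendsto_mult_right_zero)
  qed
  show "(f \<longlongrightarrow> 0) at_top"
    by (rule Lim_null_comparison [OF always_eventually top]) (use bound filterlim_abs_real in auto)
  have "filterlim (\<lambda>x::real. \<bar>x\<bar>) at_top at_bot"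
    using filterlim_compose [OF filterlim_abs_real filterlim_uminus_at_top_at_bot] by simp
  then show "(f \<longlongrightarrow> 0) at_bot"
    by (intro Lim_null_comparison [OF always_eventually top]) (use bound in auto)
qed

lemma exp_abs_le_cosh: "exp \<bar>t\<bar> \<le> 2 * cosh (t::real)"
  by (cases "t \<ge> 0") (auto simp: cosh_def)

section \<open>Calculus of the profile\<close>

locale solitary_wave =
  fixes \<sigma> \<omega> c :: real
  assumes sigma_pos: "\<sigma> > 0" and Omega: "(\<omega>, c) \<in> Omega"
begin

lemma omega_pos: "\<omega> > 0" and c_bounds: "- 2 * sqrt \<omega> < c" "c < 2 * sqrt \<omega>"
  using Omega by (auto simp: Omega_def)

definition \<kappa> :: real where "\<kappa> = sqrt (4 * \<omega> - c\<^sup>2)"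

definition D :: "real \<Rightarrow> real" where "D x = 2 * sqrt \<omega> * cosh (\<sigma> * \<kappa> * x) - c"

text \<open>
  Up to the factor \<open>\<sigma> + 1\<close> this is \<open>varphi powr (2 * \<sigma>)\<close>, so the phase of the profile has derivative
  \<open>c / 2 - q / 2\<close>.
\<close>
definition q :: "real \<Rightarrow> real" where "q x = \<kappa>\<^sup>2 / D x"

text \<open>
  The logarithmic derivative \<open>\<phi>' / \<phi>\<close>: its real part is that of the modulus, its imaginary part is
  the derivative of the phase, both over the common denominator \<open>D\<close>.
\<close>
definition h :: "real \<Rightarrow> complex" where
  "h x = Complex (- \<kappa> * sqrt \<omega> * sinh (\<sigma> * \<kappa> * x)) (c * sqrt \<omega> * cosh (\<sigma> * \<kappa> * x) - 2 * \<omega>)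
     / complex_of_real (D x)"

lemma kappa_square_factor: "4 * \<omega> - c\<^sup>2 = (2 * sqrt \<omega> - c) * (2 * sqrt \<omega> + c)"
  using omega_pos by (simp add: algebra_simps power2_eq_square)

lemma kappa_square: "\<kappa>\<^sup>2 = 4 * \<omega> - c\<^sup>2" and kappa_pos: "\<kappa> > 0"
proof -
  have "4 * \<omega> - c\<^sup>2 > 0"
    unfolding kappa_square_factor using c_bounds by simp
  then show "\<kappa>\<^sup>2 = 4 * \<omega> - c\<^sup>2" "\<kappa> > 0"
    by (simp_all add: \<kappa>_def)
qed

lemma kappa_le: "\<kappa> \<le> 2 * sqrt \<omega>"
proof -
  have "\<kappa> \<le> sqrt (4 * \<omega>)"
    unfolding \<kappa>_def by (rule real_sqrt_le_mono) simp
  then show ?thesis by (simp add: real_sqrt_mult)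
qed

lemma D_ge: "D x \<ge> 2 * sqrt \<omega> - c"
proof -
  have "2 * sqrt \<omega> * 1 \<le> 2 * sqrt \<omega> * cosh (\<sigma> * \<kappa> * x)"
    using omega_pos by (intro mult_left_mono cosh_real_ge_1) auto
  then show ?thesis by (simp add: D_def)
qed

lemma D_pos: "D x > 0"
  using D_ge [of x] c_bounds by linarith

lemma q_pos: "q x > 0"
  using D_pos kappa_pos by (simp add: q_def)

text \<open>
  The numerator \<open>\<kappa>\<^sup>2\<close> contains the factor \<open>2 * sqrt \<omega> - c\<close>, which is also the minimum of the denominator;
  cancelling it gives a bound that is uniform in \<open>c\<close>, even where \<open>D\<close> becomes small as \<open>c\<close> approaches
  \<open>2 * sqrt \<omega>\<close>.
\<close>
lemma q_le: "q x \<le> 4 * sqrt \<omega>"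
proof -
  have "\<kappa>\<^sup>2 = (2 * sqrt \<omega> - c) * (2 * sqrt \<omega> + c)"
    by (simp add: kappa_square kappa_square_factor)
  also have "\<dots> \<le> D x * (4 * sqrt \<omega>)"
    using D_ge [of x] D_pos [of x] c_bounds by (intro mult_mono) auto
  finally show ?thesis
    using D_pos [of x] by (simp add: q_def field_simps)
qed

lemma varphi_eq: "varphi \<sigma> \<omega> c x = ((\<sigma> + 1) * q x) powr (1 / (2 * \<sigma>))"
  unfolding varphi_def q_def D_def kappa_square by (simp add: \<kappa>_def)

lemma varphi_pos: "varphi \<sigma> \<omega> c x > 0"
  using sigma_pos q_pos [of x] by (simp add: varphi_eq)

lemma varphi_powr: "varphi \<sigma> \<omega> c x powr (2 * \<sigma>) = (\<sigma> + 1) * q x"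
  using sigma_pos q_pos [of x] by (simp add: varphi_eq powr_powr)

lemma varphi_square: "(varphi \<sigma> \<omega> c x)\<^sup>2 = ((\<sigma> + 1) * q x) powr (1 / \<sigma>)"
  using sigma_pos q_pos [of x] by (simp add: varphi_eq power2_eq_square flip: powr_add)

lemma D_derivative:
  "(D has_real_derivative 2 * sqrt \<omega> * \<sigma> * \<kappa> * sinh (\<sigma> * \<kappa> * x)) (at x)"
  unfolding D_def [abs_def] by (auto intro!: derivative_eq_intros)

lemma q_derivative:
  "(q has_real_derivative - q x * (2 * sqrt \<omega> * \<sigma> * \<kappa> * sinh (\<sigma> * \<kappa> * x)) / D x) (at x)"
  unfolding q_def [abs_def] using D_pos [of x]
  by (auto intro!: derivative_eq_intros D_derivative simp: field_simps power2_eq_square)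

lemma continuous_q: "continuous_on UNIV q"
  using q_derivative by (meson DERIV_continuous continuous_at_imp_continuous_on)

lemma varphi_derivative:
  "(varphi \<sigma> \<omega> c has_real_derivative
     varphi \<sigma> \<omega> c x * (- \<kappa> * sqrt \<omega> * sinh (\<sigma> * \<kappa> * x) / D x)) (at x)"
proof -
  have pos: "0 < (\<sigma> + 1) * q x"
    using sigma_pos q_pos [of x] by simp
  have "((\<lambda>x. ((\<sigma> + 1) * q x) powr (1 / (2 * \<sigma>))) has_real_derivative
      (1 / (2 * \<sigma>)) * ((\<sigma> + 1) * q x) powr (1 / (2 * \<sigma>) - 1)
        * ((\<sigma> + 1) * (- q x * (2 * sqrt \<omega> * \<sigma> * \<kappa> * sinh (\<sigma> * \<kappa> * x)) / D x))) (at x)"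
    using DERIV_fun_powr [OF DERIV_cmult [OF q_derivative] pos, of "1 / (2 * \<sigma>)"]
    by (simp only: of_nat_1)
  moreover have "(1 / (2 * \<sigma>)) * ((\<sigma> + 1) * q x) powr (1 / (2 * \<sigma>) - 1)
        * ((\<sigma> + 1) * (- q x * (2 * sqrt \<omega> * \<sigma> * \<kappa> * sinh (\<sigma> * \<kappa> * x)) / D x))
      = varphi \<sigma> \<omega> c x * (- \<kappa> * sqrt \<omega> * sinh (\<sigma> * \<kappa> * x) / D x)"
  proof -
    have "((\<sigma> + 1) * q x) powr (1 / (2 * \<sigma>) - 1) = varphi \<sigma> \<omega> c x / ((\<sigma> + 1) * q x)"
      using sigma_pos q_pos [of x] by (simp add: powr_diff varphi_eq)
    moreover have "1 / (2 * \<sigma>) * (v / (p * y)) * (p * (- y * (2 * w * \<sigma> * k * s) / d)) = v * (- k * w * s / d)"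
      if "p > 0" "y > 0" for p y v w k s d :: real
      using that sigma_pos by (cases "d = 0") (simp_all add: field_simps)
    ultimately show ?thesis
      using sigma_pos q_pos [of x] by simp
  qed
  ultimately show ?thesis
    by (simp only: varphi_eq [abs_def])
qed

text \<open>
  From \<open>cosh t \<ge> exp \<bar>t\<bar> / 2\<close> and \<open>D x \<ge> (2 * sqrt \<omega> - max c 0) * cosh (\<sigma> * \<kappa> * x)\<close>, this is the
  factor in front of \<open>exp (- \<kappa> * \<bar>x\<bar> / 2)\<close> in the bound for \<open>varphi\<close>. The maximum discards a negative \<open>c\<close>,
  which only enlarges the denominator \<open>D\<close>.
\<close>
definition decay_const :: real where
  "decay_const = ((\<sigma> + 1) * (2 * \<kappa>\<^sup>2 / (2 * sqrt \<omega> - max c 0))) powr (1 / (2 * \<sigma>))"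

lemma q_decay: "q x \<le> 2 * \<kappa>\<^sup>2 / (2 * sqrt \<omega> - max c 0) * exp (- (\<sigma> * \<kappa> * \<bar>x\<bar>))"
proof -
  let ?C = "cosh (\<sigma> * \<kappa> * x)" and ?d = "2 * sqrt \<omega> - max c 0"
  have d: "?d > 0"
    using c_bounds omega_pos by simp
  have "c \<le> max c 0 * ?C"
    using mult_left_mono [OF cosh_real_ge_1 [of "\<sigma> * \<kappa> * x"], of "max c 0"] by simp
  then have "?d * ?C \<le> D x"
    by (simp add: D_def algebra_simps)
  moreover have "exp (\<sigma> * \<kappa> * \<bar>x\<bar>) \<le> 2 * ?C"
    using exp_abs_le_cosh [of "\<sigma> * \<kappa> * x"] sigma_pos kappa_pos by (simp add: abs_mult)
  then have "?d * (exp (\<sigma> * \<kappa> * \<bar>x\<bar>) / 2) \<le> ?d * ?C"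
    using d by (intro mult_left_mono) auto
  ultimately have "?d * exp (\<sigma> * \<kappa> * \<bar>x\<bar>) / 2 \<le> D x"
    by simp
  then have "q x \<le> \<kappa>\<^sup>2 / (?d * exp (\<sigma> * \<kappa> * \<bar>x\<bar>) / 2)"
    unfolding q_def using d D_pos [of x] by (intro divide_left_mono) auto
  then show ?thesis
    using d by (simp add: exp_minus field_simps)
qed

lemma varphi_decay: "varphi \<sigma> \<omega> c x \<le> decay_const * exp (- (\<kappa> / 2) * \<bar>x\<bar>)"
proof -
  have d: "2 * sqrt \<omega> - max c 0 > 0"
    using c_bounds omega_pos by simp
  have "(\<sigma> + 1) * q x \<le> (\<sigma> + 1) * (2 * \<kappa>\<^sup>2 / (2 * sqrt \<omega> - max c 0)) * exp (- (\<sigma> * \<kappa> * \<bar>x\<bar>))"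
    using mult_left_mono [OF q_decay [of x], of "\<sigma> + 1"] sigma_pos by (simp add: mult_ac)
  then have "varphi \<sigma> \<omega> c x \<le> ((\<sigma> + 1) * (2 * \<kappa>\<^sup>2 / (2 * sqrt \<omega> - max c 0)) * exp (- (\<sigma> * \<kappa> * \<bar>x\<bar>)))
      powr (1 / (2 * \<sigma>))"
    unfolding varphi_eq using sigma_pos q_pos [of x] by (intro powr_mono2) auto
  also have "\<dots> = decay_const * exp (- (\<sigma> * \<kappa> * \<bar>x\<bar>)) powr (1 / (2 * \<sigma>))"
    unfolding decay_const_def by (rule powr_mult)
  also have "exp (- (\<sigma> * \<kappa> * \<bar>x\<bar>)) powr (1 / (2 * \<sigma>)) = exp (- (\<kappa> / 2) * \<bar>x\<bar>)"
    using sigma_pos by (simp add: powr_def)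
  finally show ?thesis .
qed

lemma integrable_q: "integrable lborel q"
proof (rule integrable_exp_decay [OF _ continuous_q])
  show "\<sigma> * \<kappa> > 0" using sigma_pos kappa_pos by simp
  show "norm (q x) \<le> 2 * \<kappa>\<^sup>2 / (2 * sqrt \<omega> - max c 0) * exp (- (\<sigma> * \<kappa>) * \<bar>x\<bar>)" for x
    using q_decay [of x] q_pos [of x] by simp
qed

definition \<theta> :: "real \<Rightarrow> real" where
  "\<theta> x = c / 2 * x - (LINT y:{..x}|lborel. q y) / 2"

text \<open>
  The relation \<open>\<kappa>\<^sup>2 = 4 * \<omega> - c\<^sup>2\<close> merges \<open>c / 2\<close> and \<open>q / 2\<close> into a single fraction with denominator \<open>D\<close>.
\<close>
lemma theta_derivative:
  "(\<theta> has_real_derivative (c * sqrt \<omega> * cosh (\<sigma> * \<kappa> * x) - 2 * \<omega>) / D x) (at x)"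
proof -
  have "(\<theta> has_real_derivative c / 2 - q x / 2) (at x)"
    unfolding \<theta>_def [abs_def]
    by (auto intro!: derivative_eq_intros has_real_derivative_integral_atMost continuous_q integrable_q)
  also have "c / 2 - q x / 2 = (c * D x - \<kappa>\<^sup>2) / (2 * D x)"
    using D_pos [of x] by (simp add: q_def field_simps)
  also have "c * D x - \<kappa>\<^sup>2 = 2 * (c * sqrt \<omega> * cosh (\<sigma> * \<kappa> * x) - 2 * \<omega>)"
    unfolding kappa_square D_def by (simp add: algebra_simps power2_eq_square)
  also have "2 * (c * sqrt \<omega> * cosh (\<sigma> * \<kappa> * x) - 2 * \<omega>) / (2 * D x)
      = (c * sqrt \<omega> * cosh (\<sigma> * \<kappa> * x) - 2 * \<omega>) / D x"
    by (rule mult_divide_mult_cancel_left) simp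
  finally show ?thesis .
qed

lemma phi_eq: "phi \<sigma> \<omega> c x = complex_of_real (varphi \<sigma> \<omega> c x) * cis (\<theta> x)"
proof -
  have "(LINT y:{..x}|lborel. varphi \<sigma> \<omega> c y powr (2 * \<sigma>)) = (\<sigma> + 1) * (LINT y:{..x}|lborel. q y)"
    by (simp add: varphi_powr)
  moreover have "complex_of_real (c / 2) * \<i> * complex_of_real x
      - \<i> / complex_of_real (2 * \<sigma> + 2) * complex_of_real ((\<sigma> + 1) * I)
      = \<i> * complex_of_real (c / 2 * x - I / 2)" for I
  proof -
    have "complex_of_real ((\<sigma> + 1) * I) = complex_of_real (2 * \<sigma> + 2) * complex_of_real (I / 2)"
      unfolding of_real_mult [symmetric] by (intro arg_cong [of _ _ complex_of_real]) (simp add: algebra_simps)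
    moreover have "complex_of_real (2 * \<sigma> + 2) \<noteq> 0"
      using sigma_pos unfolding of_real_eq_0_iff by simp
    ultimately have "\<i> / complex_of_real (2 * \<sigma> + 2) * complex_of_real ((\<sigma> + 1) * I) = \<i> * complex_of_real (I / 2)"
      by (simp del: of_real_add of_real_mult of_real_divide)
    then show ?thesis
      by (simp only:) (simp add: algebra_simps)
  qed
  ultimately show ?thesis
    by (simp only: phi_def cis_conv_exp \<theta>_def)
qed

lemma norm_phi: "norm (phi \<sigma> \<omega> c x) = varphi \<sigma> \<omega> c x"
  using varphi_pos [of x] by (simp add: phi_eq norm_mult)

lemma phi_derivative: "(phi \<sigma> \<omega> c has_vector_derivative phi \<sigma> \<omega> c x * h x) (at x)"
proof -
  let ?u = "- \<kappa> * sqrt \<omega> * sinh (\<sigma> * \<kappa> * x)" and ?v = "c * sqrt \<omega> * cosh (\<sigma> * \<kappa> * x) - 2 * \<omega>"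
  have cis: "((\<lambda>x. cis (\<theta> x)) has_vector_derivative (?v / D x) *\<^sub>R (\<i> * cis (\<theta> x))) (at x)"
    using has_derivative_cis [OF theta_derivative [of x, unfolded has_field_derivative_def]]
    by (simp add: has_vector_derivative_def mult.commute)
  have deriv: "((\<lambda>x. varphi \<sigma> \<omega> c x *\<^sub>R cis (\<theta> x)) has_vector_derivative
      varphi \<sigma> \<omega> c x *\<^sub>R ((?v / D x) *\<^sub>R (\<i> * cis (\<theta> x)))
        + (varphi \<sigma> \<omega> c x * (?u / D x)) *\<^sub>R cis (\<theta> x)) (at x)"
    by (rule has_vector_derivative_scaleR [OF varphi_derivative cis])
  have "h x = complex_of_real (?u / D x) + \<i> * complex_of_real (?v / D x)"
    by (simp add: h_def complex_eq_iff)
  moreover have "r *\<^sub>R (v *\<^sub>R (\<i> * z)) + (r * u) *\<^sub>R z = (complex_of_real r * z) * (complex_of_real u + \<i> * complex_of_real v)"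
    for r u v z
    by (simp add: scaleR_conv_of_real algebra_simps)
  ultimately have "varphi \<sigma> \<omega> c x *\<^sub>R ((?v / D x) *\<^sub>R (\<i> * cis (\<theta> x)))
        + (varphi \<sigma> \<omega> c x * (?u / D x)) *\<^sub>R cis (\<theta> x) = phi \<sigma> \<omega> c x * h x"
    by (simp only: phi_eq)
  with deriv show ?thesis
    by (simp add: phi_eq [abs_def] scaleR_conv_of_real)
qed

text \<open>
  The key identity. The square of the numerator of \<open>h\<close> is
  \<open>\<kappa>\<^sup>2 * \<omega> * sinh\<^sup>2 + (c * sqrt \<omega> * cosh - 2 * \<omega>)\<^sup>2\<close>; with \<open>\<kappa>\<^sup>2 = 4 * \<omega> - c\<^sup>2\<close> it collapses to the perfect
  square \<open>\<omega> * (2 * sqrt \<omega> * cosh - c)\<^sup>2\<close>.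
\<close>
lemma norm_h: "norm (h x) = sqrt \<omega>"
proof -
  let ?C = "cosh (\<sigma> * \<kappa> * x)" and ?S = "sinh (\<sigma> * \<kappa> * x)"
  define w where "w = sqrt \<omega>"
  have ww: "w * w = \<omega>" and w: "w \<ge> 0" using omega_pos by (auto simp: w_def)
  have CS: "?C * ?C = ?S * ?S + 1" using cosh_square_eq [of "\<sigma> * \<kappa> * x"] by (simp add: power2_eq_square)
  have kk: "\<kappa> * \<kappa> = 4 * (w * w) - c * c" unfolding ww using kappa_square by (simp add: power2_eq_square)
  have D: "D x = 2 * w * ?C - c" by (simp add: D_def w_def)
  have "(- \<kappa> * w * ?S)\<^sup>2 + (c * w * ?C - 2 * \<omega>)\<^sup>2 = (w * D x)\<^sup>2"
    unfolding D power2_eq_square using CS kk ww by algebra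
  then have "cmod (Complex (- \<kappa> * w * ?S) (c * w * ?C - 2 * \<omega>)) = w * D x"
    using w D_pos [of x] by (simp add: complex_norm)
  then show ?thesis
    using D_pos [of x] by (simp add: h_def norm_divide flip: w_def)
qed

text \<open>
  Since \<open>\<bar>h\<bar>\<close> is constant, \<open>h'\<close> must be an imaginary multiple of \<open>h\<close>. That the multiple is
  \<open>- \<i> * \<sigma> * q\<close> is the equation of the solitary wave in disguise; it is verified separately for the real
  and the imaginary part.
\<close>
lemma h_derivative: "(h has_vector_derivative - \<i> * \<sigma> * q x * h x) (at x)"
proof -
  let ?C = "cosh (\<sigma> * \<kappa> * x)" and ?S = "sinh (\<sigma> * \<kappa> * x)"
  define w where "w = sqrt \<omega>"
  have ww: "w * w = \<omega>" using omega_pos by (auto simp: w_def)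
  have CS: "?C * ?C = ?S * ?S + 1" using cosh_square_eq [of "\<sigma> * \<kappa> * x"] by (simp add: power2_eq_square)
  have kk: "\<kappa> * \<kappa> = 4 * (w * w) - c * c" unfolding ww using kappa_square by (simp add: power2_eq_square)
  have D: "D x = 2 * w * ?C - c" by (simp add: D_def w_def)
  have Dnz: "D x \<noteq> 0" using D_pos [of x] by simp
  have re: "((\<lambda>x. - \<kappa> * w * sinh (\<sigma> * \<kappa> * x) / D x) has_real_derivative
      \<sigma> * q x * ((c * w * ?C - 2 * \<omega>) / D x)) (at x)"
  proof -
    have "((\<lambda>x. - \<kappa> * w * sinh (\<sigma> * \<kappa> * x) / D x) has_real_derivative
      ((- \<kappa> * w * (?C * (\<sigma> * \<kappa>))) * D x - (- \<kappa> * w * ?S) * (2 * sqrt \<omega> * \<sigma> * \<kappa> * ?S)) / (D x * D x)) (at x)"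
      by (rule DERIV_divide [OF _ D_derivative Dnz]) (auto intro!: derivative_eq_intros)
    moreover have "(- \<kappa> * w * (?C * (\<sigma> * \<kappa>))) * D x - (- \<kappa> * w * ?S) * (2 * sqrt \<omega> * \<sigma> * \<kappa> * ?S)
        = \<sigma> * \<kappa>\<^sup>2 * (c * w * ?C - 2 * \<omega>)"
      unfolding D w_def [symmetric] power2_eq_square using CS ww by algebra
    ultimately show ?thesis
      by (simp add: q_def power2_eq_square)
  qed
  have im: "((\<lambda>x. (c * w * cosh (\<sigma> * \<kappa> * x) - 2 * \<omega>) / D x) has_real_derivative
      - (\<sigma> * q x * (- \<kappa> * w * ?S / D x))) (at x)"
  proof -
    have "((\<lambda>x. (c * w * cosh (\<sigma> * \<kappa> * x) - 2 * \<omega>) / D x) has_real_derivative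
      ((c * w * (?S * (\<sigma> * \<kappa>))) * D x - (c * w * ?C - 2 * \<omega>) * (2 * sqrt \<omega> * \<sigma> * \<kappa> * ?S)) / (D x * D x)) (at x)"
      by (rule DERIV_divide [OF _ D_derivative Dnz]) (auto intro!: derivative_eq_intros)
    moreover have "(c * w * (?S * (\<sigma> * \<kappa>))) * D x - (c * w * ?C - 2 * \<omega>) * (2 * sqrt \<omega> * \<sigma> * \<kappa> * ?S)
        = \<sigma> * \<kappa>\<^sup>2 * (\<kappa> * w * ?S)"
      unfolding D w_def [symmetric] power2_eq_square using CS kk ww by algebra
    ultimately show ?thesis
      by (simp add: q_def power2_eq_square)
  qed
  have h: "h = (\<lambda>x. complex_of_real (- \<kappa> * w * sinh (\<sigma> * \<kappa> * x) / D x)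
      + \<i> * complex_of_real ((c * w * cosh (\<sigma> * \<kappa> * x) - 2 * \<omega>) / D x))"
    by (auto simp: fun_eq_iff h_def complex_eq_iff w_def)
  have "(h has_vector_derivative
      complex_of_real (\<sigma> * q x * ((c * w * ?C - 2 * \<omega>) / D x))
      + \<i> * complex_of_real (- (\<sigma> * q x * (- \<kappa> * w * ?S / D x)))) (at x)"
    unfolding h
    by (intro has_vector_derivative_add has_vector_derivative_mult_right has_vector_derivative_of_real)
       (use re im in \<open>auto simp: has_real_derivative_iff_has_vector_derivative\<close>)
  also have "complex_of_real (\<sigma> * q x * ((c * w * ?C - 2 * \<omega>) / D x))
      + \<i> * complex_of_real (- (\<sigma> * q x * (- \<kappa> * w * ?S / D x))) = - \<i> * \<sigma> * q x * h x"
    by (simp add: h complex_eq_iff)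
  finally show ?thesis .
qed

lemma phi_second_derivative:
  "((\<lambda>x. phi \<sigma> \<omega> c x * h x) has_vector_derivative
     phi \<sigma> \<omega> c x * (h x * (h x - \<i> * \<sigma> * q x))) (at x)"
  using has_vector_derivative_mult [OF phi_derivative h_derivative, of x]
  by (simp add: algebra_simps)

lemma continuous_phi: "continuous_on UNIV (phi \<sigma> \<omega> c)"
  using phi_derivative by (meson continuous_at_imp_continuous_on has_vector_derivative_continuous)

lemma continuous_h: "continuous_on UNIV h"
  using h_derivative by (meson continuous_at_imp_continuous_on has_vector_derivative_continuous)

text \<open>
  The left-hand side is the modulus of \<open>\<phi>'' / \<phi> = h\<^sup>2 + h'\<close>.
\<close>
lemma norm_second_log_derivative_le: "norm (h x * (h x - \<i> * \<sigma> * q x)) \<le> (1 + 4 * \<sigma>) * \<omega>"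
proof -
  have "norm (h x - \<i> * \<sigma> * q x) \<le> norm (h x) + norm (\<i> * complex_of_real \<sigma> * complex_of_real (q x))"
    by (rule norm_triangle_ineq4)
  also have "\<dots> = sqrt \<omega> + \<sigma> * q x"
    using sigma_pos q_pos [of x] by (simp add: norm_h norm_mult)
  also have "\<dots> \<le> sqrt \<omega> + \<sigma> * (4 * sqrt \<omega>)"
    using sigma_pos q_le [of x] by simp
  finally have "norm (h x) * norm (h x - \<i> * \<sigma> * q x) \<le> sqrt \<omega> * (sqrt \<omega> + \<sigma> * (4 * sqrt \<omega>))"
    unfolding norm_h using omega_pos by (intro mult_left_mono) auto
  also have "\<dots> = (1 + 4 * \<sigma>) * \<omega>"
    using omega_pos by (simp add: algebra_simps)
  finally show ?thesis
    by (simp add: norm_mult)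
qed

lemma decay_const_nonneg: "decay_const \<ge> 0"
  by (simp add: decay_const_def)

text \<open>
  The profile and its first two derivatives are products of \<open>\<phi>\<close> with bounded factors, so they
  decay at the same exponential rate.
\<close>
lemma norm_phi_mult_le:
  assumes "norm z \<le> m"
  shows "norm (phi \<sigma> \<omega> c x * z) \<le> (m * decay_const) * exp (- (\<kappa> / 2) * \<bar>x\<bar>)"
proof -
  have "norm (phi \<sigma> \<omega> c x * z) \<le> (decay_const * exp (- (\<kappa> / 2) * \<bar>x\<bar>)) * m"
    unfolding norm_mult norm_phi
    by (intro mult_mono varphi_decay assms mult_nonneg_nonneg decay_const_nonneg) auto
  then show ?thesis by (simp add: mult_ac)
qed

lemma norm_phi_square: "(norm (phi \<sigma> \<omega> c x))\<^sup>2 = ((\<sigma> + 1) * q x) powr (1 / \<sigma>)"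
  by (simp add: norm_phi varphi_square)

lemma nn_integral_phi_square_le:
  "(\<integral>\<^sup>+x. ennreal ((norm (phi \<sigma> \<omega> c x))\<^sup>2) \<partial>lborel) \<le> ennreal (decay_const\<^sup>2 * (2 / \<kappa>))"
proof -
  have "(\<integral>\<^sup>+x. ennreal ((norm (phi \<sigma> \<omega> c x))\<^sup>2) \<partial>lborel)
      \<le> (\<integral>\<^sup>+x. ennreal (decay_const\<^sup>2) * ennreal (exp (- \<kappa> * \<bar>x\<bar>)) \<partial>lborel)"
  proof (intro nn_integral_mono)
    fix x
    have "(norm (phi \<sigma> \<omega> c x))\<^sup>2 \<le> (decay_const * exp (- (\<kappa> / 2) * \<bar>x\<bar>))\<^sup>2"
      unfolding norm_phi using varphi_decay varphi_pos [of x] by (intro power_mono) auto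
    also have "\<dots> = decay_const\<^sup>2 * exp (- \<kappa> * \<bar>x\<bar>)"
      by (simp add: power_mult_distrib flip: exp_double)
    finally show "ennreal ((norm (phi \<sigma> \<omega> c x))\<^sup>2) \<le> ennreal (decay_const\<^sup>2) * ennreal (exp (- \<kappa> * \<bar>x\<bar>))"
      by (simp add: ennreal_leI flip: ennreal_mult)
  qed
  also have "\<dots> = ennreal (decay_const\<^sup>2) * ennreal (2 / \<kappa>)"
    by (subst nn_integral_cmult) (auto simp: nn_integral_exp_abs [OF kappa_pos, simplified])
  also have "\<dots> = ennreal (decay_const\<^sup>2 * (2 / \<kappa>))"
    using kappa_pos by (subst ennreal_mult) auto
  finally show ?thesis .
qed

lemma L2_norm_phi_derivative_square:
  "(L2_norm (\<lambda>x. phi \<sigma> \<omega> c x * h x))\<^sup>2 = ennreal \<omega> * (L2_norm (phi \<sigma> \<omega> c))\<^sup>2"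
proof -
  have [measurable]: "phi \<sigma> \<omega> c \<in> borel_measurable borel"
    by (rule borel_measurable_continuous_onI [OF continuous_phi])
  have "(\<integral>\<^sup>+x. ennreal ((norm (phi \<sigma> \<omega> c x * h x))\<^sup>2) \<partial>lborel)
      = (\<integral>\<^sup>+x. ennreal \<omega> * ennreal ((norm (phi \<sigma> \<omega> c x))\<^sup>2) \<partial>lborel)"
    using omega_pos by (simp add: norm_mult norm_h power_mult_distrib mult.commute flip: ennreal_mult)
  then show ?thesis
    by (simp add: L2_norm_square nn_integral_cmult)
qed

text \<open>
  The classical derivative is a weak derivative, so it is a candidate in the infimum that defines the norm. Its
  squared \<open>L\<^sup>2\<close> norm is \<open>\<omega>\<close> times that of the profile, by \<open>norm_h\<close>.
\<close>
lemma H1_norm_phi_le: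
  "H1_norm (phi \<sigma> \<omega> c) \<le> ennreal (sqrt ((1 + \<omega>) * (decay_const\<^sup>2 * (2 / \<kappa>))))"
proof -
  let ?f = "phi \<sigma> \<omega> c" and ?g = "\<lambda>x. phi \<sigma> \<omega> c x * h x" and ?K = "decay_const\<^sup>2 * (2 / \<kappa>)"
  have K: "?K \<ge> 0"
    using kappa_pos by simp
  have le: "(L2_norm ?f)\<^sup>2 \<le> ennreal ?K"
    unfolding L2_norm_square by (rule nn_integral_phi_square_le)
  have fin: "L2_norm u < \<infinity>" if "(L2_norm u)\<^sup>2 < \<infinity>" for u
    using that unfolding L2_norm_square by (simp add: L2_norm_def ennsqrt_def)
  have f_fin: "(L2_norm ?f)\<^sup>2 < \<infinity>"
    using le by (rule le_less_trans) simp
  have "?f \<in> borel_measurable borel" "?g \<in> borel_measurable borel"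
    by (intro borel_measurable_continuous_onI continuous_intros continuous_phi continuous_h)+
  moreover have "L2_norm ?f < \<infinity>"
    by (rule fin [OF f_fin])
  moreover have "L2_norm ?g < \<infinity>"
    using f_fin by (intro fin) (simp add: L2_norm_phi_derivative_square ennreal_mult_less_top)
  moreover have "weak_deriv ?f ?g"
    by (rule weak_deriv_of_derivative [OF phi_derivative])
       (intro continuous_intros continuous_phi continuous_h)
  ultimately have "H1_norm ?f \<le> ennsqrt ((L2_norm ?f)\<^sup>2 + (L2_norm ?g)\<^sup>2)"
    unfolding H1_norm_def by (intro INF_lower) (simp add: L2_fun_def)
  also have "\<dots> \<le> ennsqrt (ennreal ((1 + \<omega>) * ?K))"
  proof (rule ennsqrt_mono)
    have "(L2_norm ?f)\<^sup>2 + (L2_norm ?g)\<^sup>2 \<le> ennreal ?K + ennreal \<omega> * ennreal ?K"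
      unfolding L2_norm_phi_derivative_square by (intro add_mono mult_left_mono le) auto
    also have "\<dots> = ennreal ((1 + \<omega>) * ?K)"
    proof -
      have "ennreal k + ennreal \<omega> * ennreal k = ennreal ((1 + \<omega>) * k)" if "k \<ge> 0" for k
        using that omega_pos by (simp add: distrib_right flip: ennreal_mult ennreal_plus)
      then show ?thesis
        using K by blast
    qed
    finally show "(L2_norm ?f)\<^sup>2 + (L2_norm ?g)\<^sup>2 \<le> ennreal ((1 + \<omega>) * ?K)" .
  qed
  also have "\<dots> = ennreal (sqrt ((1 + \<omega>) * ?K))"
    using omega_pos K by (intro ennsqrt_ennreal mult_nonneg_nonneg [of "1 + \<omega>"]) simp_all
  finally show ?thesis .
qed

text \<open>
  The total exponent of \<open>\<kappa>\<close> decides the first regime: \<open>2 / \<sigma>\<close> from the amplitude of the profile and \<open>-1\<close>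
  from its width.
\<close>
lemma decay_const_square:
  assumes "c \<le> 0"
  shows "decay_const\<^sup>2 * (2 / \<kappa>) = 2 * ((\<sigma> + 1) / sqrt \<omega>) powr (1 / \<sigma>) * \<kappa> powr (2 / \<sigma> - 1)"
proof -
  let ?X = "(\<sigma> + 1) / sqrt \<omega> * \<kappa>\<^sup>2"
  have "decay_const = ?X powr (1 / (2 * \<sigma>))"
    unfolding decay_const_def using assms omega_pos
    by (intro arg_cong2 [where f = "(powr)"]) (auto simp: max_def field_simps)
  then have "decay_const\<^sup>2 = ?X powr (1 / \<sigma>)"
    using omega_pos kappa_pos sigma_pos by (simp add: power2_eq_square flip: powr_add)
  also have "\<dots> = ((\<sigma> + 1) / sqrt \<omega>) powr (1 / \<sigma>) * (\<kappa>\<^sup>2) powr (1 / \<sigma>)"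
    by (rule powr_mult)
  also have "(\<kappa>\<^sup>2) powr (1 / \<sigma>) = \<kappa> powr (2 / \<sigma>)"
    using kappa_pos by (simp add: powr_powr flip: powr_numeral)
  also have "\<kappa> powr (2 / \<sigma>) = \<kappa> powr (2 / \<sigma> - 1) * \<kappa>"
    using kappa_pos by (simp add: powr_diff)
  finally show ?thesis
    using kappa_pos by simp
qed

text \<open>
  Only the core \<open>\<bar>x\<bar> \<le> 1 / (\<sigma> * \<kappa>)\<close> is used. There \<open>cosh \<le> 3\<close>, hence \<open>D \<le> 8 * sqrt \<omega>\<close>, which is the
  origin of the constant \<open>8\<close>. The hypothesis on \<open>\<sigma>\<close> makes the exponent \<open>2 / \<sigma> - 1\<close> of \<open>\<kappa>\<close> nonpositive, so
  that \<open>\<kappa>\<close> may be replaced by its upper bound \<open>2 * sqrt \<omega>\<close>.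
\<close>
lemma nn_integral_phi_square_ge:
  assumes "\<sigma> \<ge> 2"
  shows "ennreal (2 / \<sigma> * ((\<sigma> + 1) / 8) powr (1 / \<sigma>) * 2 powr (2 / \<sigma> - 1) * \<omega> powr (- (1 / 2 - 1 / (2 * \<sigma>))))
    \<le> (\<integral>\<^sup>+x. ennreal ((norm (phi \<sigma> \<omega> c x))\<^sup>2) \<partial>lborel)"
proof -
  define r where "r = 1 / (\<sigma> * \<kappa>)"
  define K where "K = ((\<sigma> + 1) * (\<kappa>\<^sup>2 / (8 * sqrt \<omega>))) powr (1 / \<sigma>)"
  have r: "r > 0"
    using sigma_pos kappa_pos by (simp add: r_def)
  have K_le: "K \<le> (norm (phi \<sigma> \<omega> c x))\<^sup>2" if "x \<in> {-r..r}" for x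
  proof -
    let ?t = "\<sigma> * \<kappa> * x"
    have "\<bar>x\<bar> \<le> r"
      using that by auto
    then have "\<bar>?t\<bar> \<le> 1"
      using sigma_pos kappa_pos by (simp add: r_def abs_mult field_simps)
    then have "exp ?t \<le> exp 1" "exp (- ?t) \<le> exp 1"
      by auto
    then have "exp ?t \<le> 3" "exp (- ?t) \<le> 3"
      using exp_le by linarith+
    then have "cosh ?t \<le> 3"
      by (simp add: cosh_def)
    then have "2 * sqrt \<omega> * cosh ?t \<le> 2 * sqrt \<omega> * 3"
      using omega_pos by (intro mult_left_mono) auto
    then have "D x \<le> 8 * sqrt \<omega>"
      unfolding D_def using c_bounds by linarith
    then have "\<kappa>\<^sup>2 / (8 * sqrt \<omega>) \<le> q x"
      unfolding q_def using D_pos [of x] omega_pos by (intro divide_left_mono mult_pos_pos) simp_all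
    then show ?thesis
      unfolding norm_phi_square K_def using sigma_pos omega_pos
      by (intro powr_mono2 mult_left_mono) auto
  qed
  define w where "w = sqrt \<omega>"
  have w: "w > 0"
    using omega_pos by (simp add: w_def)
  have \<omega>: "\<omega> powr e = w powr (2 * e)" for e
  proof -
    have "w powr 2 = \<omega>"
      using omega_pos by (simp add: w_def)
    then show ?thesis
      by (simp only: powr_powr [symmetric])
  qed
  let ?A = "2 / \<sigma> * ((\<sigma> + 1) / 8) powr (1 / \<sigma>)"
  have A: "0 \<le> ?A"
    using sigma_pos by simp
  have eq: "2 * r * K = 2 / \<sigma> * ((\<sigma> + 1) / 8) powr (1 / \<sigma>) * (\<kappa> powr (2 / \<sigma> - 1) * w powr (- 1 / \<sigma>))"
  proof -
    have "K = (((\<sigma> + 1) / 8) * (\<kappa>\<^sup>2 * inverse w)) powr (1 / \<sigma>)"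
      unfolding K_def w_def [symmetric] using w
      by (intro arg_cong [of _ _ "\<lambda>z. z powr (1 / \<sigma>)"]) (simp add: field_simps)
    also have "\<dots> = ((\<sigma> + 1) / 8) powr (1 / \<sigma>) * ((\<kappa>\<^sup>2) powr (1 / \<sigma>) * inverse w powr (1 / \<sigma>))"
      by (simp only: powr_mult)
    also have "(\<kappa>\<^sup>2) powr (1 / \<sigma>) = \<kappa> powr (2 / \<sigma> - 1) * \<kappa>"
      using kappa_pos by (simp add: powr_powr powr_diff flip: powr_numeral)
    also have "inverse w powr (1 / \<sigma>) = w powr (- 1 / \<sigma>)"
      using w by (simp add: powr_minus inverse_powr)
    finally show ?thesis
      using kappa_pos sigma_pos by (simp add: r_def)
  qed
  have le: "2 powr (2 / \<sigma> - 1) * \<omega> powr (- (1 / 2 - 1 / (2 * \<sigma>)))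
      \<le> \<kappa> powr (2 / \<sigma> - 1) * w powr (- 1 / \<sigma>)"
  proof -
    have "(2 * w) powr (2 / \<sigma> - 1) \<le> \<kappa> powr (2 / \<sigma> - 1)"
      using kappa_le kappa_pos assms by (intro powr_mono2') (auto simp: w_def)
    then have "(2 * w) powr (2 / \<sigma> - 1) * w powr (- 1 / \<sigma>) \<le> \<kappa> powr (2 / \<sigma> - 1) * w powr (- 1 / \<sigma>)"
      by (rule mult_right_mono) simp
    moreover have "(2 * w) powr (2 / \<sigma> - 1) * w powr (- 1 / \<sigma>)
        = 2 powr (2 / \<sigma> - 1) * \<omega> powr (- (1 / 2 - 1 / (2 * \<sigma>)))"
    proof -
      have exponent: "(2 / \<sigma> - 1) + (- 1 / \<sigma>) = 2 * (- (1 / 2 - 1 / (2 * \<sigma>)))"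
        using sigma_pos by (simp add: field_simps)
      have "w powr (2 / \<sigma> - 1) * w powr (- 1 / \<sigma>) = \<omega> powr (- (1 / 2 - 1 / (2 * \<sigma>)))"
        unfolding \<omega> powr_add [symmetric] exponent ..
      then show ?thesis
        unfolding powr_mult mult.assoc by (rule arg_cong)
    qed
    ultimately show ?thesis
      by (rule ord_eq_le_trans [OF sym, rotated])
  qed
  have "?A * (2 powr (2 / \<sigma> - 1) * \<omega> powr (- (1 / 2 - 1 / (2 * \<sigma>)))) \<le> 2 * r * K"
    unfolding eq by (rule mult_left_mono [OF le A])
  then have "ennreal (2 / \<sigma> * ((\<sigma> + 1) / 8) powr (1 / \<sigma>) * 2 powr (2 / \<sigma> - 1) * \<omega> powr (- (1 / 2 - 1 / (2 * \<sigma>))))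
      \<le> ennreal (2 * r * K)"
    by (intro ennreal_leI) (simp only: mult.assoc)
  also have "\<dots> = (\<integral>\<^sup>+x. ennreal K * indicator {-r..r} x \<partial>lborel)"
    using r by (subst nn_integral_cmult_indicator) (auto simp: K_def mult.commute simp flip: ennreal_mult)
  also have "\<dots> \<le> (\<integral>\<^sup>+x. ennreal ((norm (phi \<sigma> \<omega> c x))\<^sup>2) \<partial>lborel)"
    by (intro nn_integral_mono) (auto simp: indicator_def intro!: ennreal_leI K_le)
  finally show ?thesis .
qed

lemma hom_sobolev_norm_phi_ge:
  assumes "\<sigma> \<ge> 2"
  shows "ennreal (sqrt (2 / \<sigma> * ((\<sigma> + 1) / 8) powr (1 / \<sigma>) * 2 powr (2 / \<sigma> - 1)
      / (2 * (2 * (1 + 4 * \<sigma>)\<^sup>2) powr (1 - (1 / 2 - 1 / (2 * \<sigma>))))))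
    \<le> hom_sobolev_norm (1 / 2 - 1 / (2 * \<sigma>)) (phi \<sigma> \<omega> c)"
proof -
  let ?f = "phi \<sigma> \<omega> c" and ?f1 = "\<lambda>x. phi \<sigma> \<omega> c x * h x"
    and ?f2 = "\<lambda>x. phi \<sigma> \<omega> c x * (h x * (h x - \<i> * \<sigma> * q x))"
  have k: "\<kappa> / 2 > 0" using kappa_pos by simp
  have decay: "norm (?f x) \<le> (1 * decay_const) * exp (- (\<kappa> / 2) * \<bar>x\<bar>)"
      "norm (?f1 x) \<le> (sqrt \<omega> * decay_const) * exp (- (\<kappa> / 2) * \<bar>x\<bar>)"
      "norm (?f2 x) \<le> ((1 + 4 * \<sigma>) * \<omega> * decay_const) * exp (- (\<kappa> / 2) * \<bar>x\<bar>)" for x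
    using norm_phi_mult_le [of 1 1 x] norm_phi_mult_le [of "h x" "sqrt \<omega>" x]
      norm_phi_mult_le [OF norm_second_log_derivative_le [of x], of x] by (simp_all add: norm_h)
  have cont: "continuous_on UNIV ?f1" "continuous_on UNIV ?f2"
    by (intro continuous_intros continuous_phi continuous_h continuous_q)+
  show ?thesis
  proof (rule hom_sobolev_norm_ge [OF phi_derivative phi_second_derivative cont(2)])
    show "integrable lborel ?f" "integrable lborel ?f1" "integrable lborel ?f2"
      by (rule integrable_exp_decay [OF k continuous_phi decay(1)]
          integrable_exp_decay [OF k cont(1) decay(2)] integrable_exp_decay [OF k cont(2) decay(3)])+
    show "(?f \<longlongrightarrow> 0) at_top" "(?f \<longlongrightarrow> 0) at_bot" "(?f1 \<longlongrightarrow> 0) at_top" "(?f1 \<longlongrightarrow> 0) at_bot"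
      by (rule tendsto_0_exp_decay [OF k decay(1)] tendsto_0_exp_decay [OF k decay(2)])+
    show "norm (?f1 x) \<le> sqrt \<omega> * decay_const" for x
    proof -
      have "(sqrt \<omega> * decay_const) * exp (- (\<kappa> / 2) * \<bar>x\<bar>) \<le> (sqrt \<omega> * decay_const) * 1"
        using kappa_pos omega_pos decay_const_nonneg by (intro mult_left_mono) auto
      with decay(2) [of x] show ?thesis by simp
    qed
    show "norm (?f1 x) = sqrt \<omega> * norm (?f x)" for x
      by (simp add: norm_mult norm_h)
    show "norm (?f2 x) \<le> (1 + 4 * \<sigma>) * \<omega> * norm (?f x)" for x
    proof -
      have "norm (?f2 x) = norm (h x * (h x - \<i> * \<sigma> * q x)) * norm (?f x)"
        by (simp only: norm_mult mult.commute)
      also have "\<dots> \<le> (1 + 4 * \<sigma>) * \<omega> * norm (?f x)"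
        by (rule mult_right_mono [OF norm_second_log_derivative_le]) simp
      finally show ?thesis .
    qed
    show "\<omega> > 0" "1 + 4 * \<sigma> > 0"
      using omega_pos sigma_pos by auto
    show "0 \<le> 1 / 2 - 1 / (2 * \<sigma>)" "1 / 2 - 1 / (2 * \<sigma>) \<le> 1"
      using assms by (auto simp: field_simps)
    show "0 \<le> 2 / \<sigma> * ((\<sigma> + 1) / 8) powr (1 / \<sigma>) * 2 powr (2 / \<sigma> - 1)"
      using sigma_pos by simp
    show "ennreal (2 / \<sigma> * ((\<sigma> + 1) / 8) powr (1 / \<sigma>) * 2 powr (2 / \<sigma> - 1)
        * \<omega> powr (- (1 / 2 - 1 / (2 * \<sigma>)))) \<le> (\<integral>\<^sup>+x. ennreal ((norm (?f x))\<^sup>2) \<partial>lborel)"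
      by (rule nn_integral_phi_square_ge [OF assms])
  qed
qed

end

section \<open>The two regimes\<close>

lemma H1_norm_phi_tendsto_0:
  assumes "\<sigma> > 0" "\<sigma> < 2" "\<omega> > 0"
  shows "((\<lambda>c. H1_norm (phi \<sigma> \<omega> c)) \<longlongrightarrow> 0) (at (- 2 * sqrt \<omega>) within {c. (\<omega>, c) \<in> Omega})"
    (is "(_ \<longlongrightarrow> 0) ?F")
proof -
  define b where "b c = sqrt ((1 + \<omega>) * (2 * ((\<sigma> + 1) / sqrt \<omega>) powr (1 / \<sigma>)
      * sqrt (4 * \<omega> - c\<^sup>2) powr (2 / \<sigma> - 1)))" for c
  have "\<forall>\<^sub>F c in ?F. c < 0"
    using order_tendstoD(2) [OF tendsto_ident_at, of "- 2 * sqrt \<omega>" 0] assms by simp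
  moreover have in_Omega: "\<forall>\<^sub>F c in ?F. (\<omega>, c) \<in> Omega"
    by (auto simp: eventually_at_filter)
  ultimately have le: "\<forall>\<^sub>F c in ?F. H1_norm (phi \<sigma> \<omega> c) \<le> ennreal (b c)"
  proof eventually_elim
    case (elim c)
    then interpret solitary_wave \<sigma> \<omega> c
      using assms by unfold_locales
    have "decay_const\<^sup>2 * (2 / \<kappa>) = 2 * ((\<sigma> + 1) / sqrt \<omega>) powr (1 / \<sigma>) * \<kappa> powr (2 / \<sigma> - 1)"
      using elim by (intro decay_const_square) simp
    then have "b c = sqrt ((1 + \<omega>) * (decay_const\<^sup>2 * (2 / \<kappa>)))"
      by (simp only: b_def \<kappa>_def)
    then show ?case
      using H1_norm_phi_le by simp
  qed
  have "((\<lambda>c. sqrt (4 * \<omega> - c\<^sup>2)) \<longlongrightarrow> sqrt (4 * \<omega> - (- 2 * sqrt \<omega>)\<^sup>2)) ?F"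
    by (intro tendsto_intros)
  then have lim: "((\<lambda>c. sqrt (4 * \<omega> - c\<^sup>2)) \<longlongrightarrow> 0) ?F"
    using assms by (simp add: power_mult_distrib)
  have nonneg: "\<forall>\<^sub>F c in ?F. 0 \<le> sqrt (4 * \<omega> - c\<^sup>2)"
    using in_Omega
  proof eventually_elim
    case (elim c)
    then interpret solitary_wave \<sigma> \<omega> c
      using assms by unfold_locales
    show ?case
      using kappa_pos unfolding \<kappa>_def by (rule less_imp_le)
  qed
  have "2 / \<sigma> - 1 > 0"
    using assms by simp
  then have "((\<lambda>c. sqrt (4 * \<omega> - c\<^sup>2) powr (2 / \<sigma> - 1)) \<longlongrightarrow> 0) ?F"
    by (rule tendsto_zero_powrI [OF lim tendsto_const nonneg])
  then have "(b \<longlongrightarrow> sqrt ((1 + \<omega>) * (2 * ((\<sigma> + 1) / sqrt \<omega>) powr (1 / \<sigma>) * 0))) ?F"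
    unfolding b_def [abs_def] by (intro tendsto_real_sqrt tendsto_mult_left)
  then have "((\<lambda>c. ennreal (b c)) \<longlongrightarrow> ennreal 0) ?F"
    by (intro tendsto_ennrealI) simp
  then show ?thesis
    by (intro tendsto_sandwich [OF _ le tendsto_const]) auto
qed

theorem theorem1p1:
  fixes \<sigma> :: real
  assumes "\<sigma> > 0"
  shows "(\<sigma> < 2 \<longrightarrow>
            (\<forall>\<omega>::real. \<omega> > 0 \<longrightarrow>
               ((\<lambda>c. H1_norm (phi \<sigma> \<omega> c)) \<longlongrightarrow> 0)
                 (at (- 2 * sqrt \<omega>) within {c. (\<omega>, c) \<in> Omega})))
       \<and> (\<sigma> \<ge> 2 \<longrightarrow>
            (\<exists>c\<^sub>0::real. c\<^sub>0 > 0 \<and>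
               (\<forall>(\<omega>, c) \<in> Omega.
                  hom_sobolev_norm (1 / 2 - 1 / (2 * \<sigma>)) (phi \<sigma> \<omega> c) \<ge> ennreal c\<^sub>0)))"
proof (intro conjI impI allI)
  show "((\<lambda>c. H1_norm (phi \<sigma> \<omega> c)) \<longlongrightarrow> 0) (at (- 2 * sqrt \<omega>) within {c. (\<omega>, c) \<in> Omega})"
    if "\<sigma> < 2" "\<omega> > 0" for \<omega>
    using H1_norm_phi_tendsto_0 assms that by blast
next
  assume "\<sigma> \<ge> 2"
  let ?c0 = "sqrt (2 / \<sigma> * ((\<sigma> + 1) / 8) powr (1 / \<sigma>) * 2 powr (2 / \<sigma> - 1)
      / (2 * (2 * (1 + 4 * \<sigma>)\<^sup>2) powr (1 - (1 / 2 - 1 / (2 * \<sigma>)))))"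
  have "?c0 > 0"
    using assms by (auto intro!: divide_pos_pos mult_pos_pos)
  moreover have "\<forall>(\<omega>, c) \<in> Omega. hom_sobolev_norm (1 / 2 - 1 / (2 * \<sigma>)) (phi \<sigma> \<omega> c) \<ge> ennreal ?c0"
    using solitary_wave.hom_sobolev_norm_phi_ge [OF solitary_wave.intro [OF assms] \<open>\<sigma> \<ge> 2\<close>] by blast
  ultimately show "\<exists>c\<^sub>0::real. c\<^sub>0 > 0 \<and>
      (\<forall>(\<omega>, c) \<in> Omega. hom_sobolev_norm (1 / 2 - 1 / (2 * \<sigma>)) (phi \<sigma> \<omega> c) \<ge> ennreal c\<^sub>0)"
    by blast
qed

end
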